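(* There is a subdirectly irreducible modular ortholattice of infinite height which is generated (as an ortholattice) by an orthogonal $3$-frame.
   Context: A modular ortholattice (MOL) is a bounded modular lattice (join $+$, meet written as product) with an order-reversing involution $x\mapsto x'$ such that $x+x'=1$ and $xx'=0$; it is an algebra in the signature $(+,\cdot,{}',0,1)$. Infinite height means that there is no finite maximal chain from $0$ to $1$. "Generated by" a set of elements means: the smallest subset containing these elements and closed under all operations $+,\cdot,{}',0,1$ is the whole algebra. A $3$-frame in a lattice is a list of elements $a_i,a_{ij}$ ($i,j\in\{1,2,3\}$, $i\neq j$) such that for any three distinct $j,k,l$: $a_j\sum_{i\ne j}a_i=\prod_i a_i=a_ja_{jk}$, $a_j+a_{jk}=a_j+a_k$, and $a_{jl}=a_{lj}=(a_j+a_l)(a_{jk}+a_{kl})$. In an MOL, a frame is orthogonal if $a_j\le a_k'$ for all $j\ne k$. *)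

theory Defs
  imports Main "HOL.Hull" "HOL.Zorn" "HOL-Algebra.Lattice"
begin

text \<open>
  The order of a lattice determines its operations and bounds, so an ortholattice is given
  as an order structure with one additional operation; joins, meets and the two constants
  are the \<open>\<squnion>\<close>, \<open>\<sqinter>\<close>, \<open>\<bottom>\<close>, \<open>\<top>\<close> of that order.
  An ortholattice generated by a finite set is countable, so it has an isomorphic copy whose
  carrier is a set of natural numbers; existence may thus be stated over type \<open>nat\<close>.
\<close>

record 'a ortho_gorder = "'a gorder" +
  ortho :: "'a \<Rightarrow> 'a"

locale modular_ortholattice = bounded_lattice L for L (structure) +
  assumes modular:
      "\<lbrakk>x \<in> carrier L; y \<in> carrier L; z \<in> carrier L; x \<sqsubseteq> z\<rbrakk>
        \<Longrightarrow> x \<squnion> (y \<sqinter> z) = (x \<squnion> y) \<sqinter> z"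
    and ortho_closed: "x \<in> carrier L \<Longrightarrow> ortho L x \<in> carrier L"
    and ortho_involution: "x \<in> carrier L \<Longrightarrow> ortho L (ortho L x) = x"
    and ortho_antimono:
      "\<lbrakk>x \<in> carrier L; y \<in> carrier L; x \<sqsubseteq> y\<rbrakk> \<Longrightarrow> ortho L y \<sqsubseteq> ortho L x"
    and join_ortho: "x \<in> carrier L \<Longrightarrow> x \<squnion> ortho L x = \<top>"
    and meet_ortho: "x \<in> carrier L \<Longrightarrow> x \<sqinter> ortho L x = \<bottom>"

definition ol_congruence :: "('a, 'm) ortho_gorder_scheme \<Rightarrow> ('a \<times> 'a) set \<Rightarrow> bool" where
  "ol_congruence L \<theta> \<longleftrightarrow>
     equiv (carrier L) \<theta> \<and>
     (\<forall>x y u v. (x, y) \<in> \<theta> \<longrightarrow> (u, v) \<in> \<theta> \<longrightarrow>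
        (x \<squnion>\<^bsub>L\<^esub> u, y \<squnion>\<^bsub>L\<^esub> v) \<in> \<theta> \<and> (x \<sqinter>\<^bsub>L\<^esub> u, y \<sqinter>\<^bsub>L\<^esub> v) \<in> \<theta>) \<and>
     (\<forall>x y. (x, y) \<in> \<theta> \<longrightarrow> (ortho L x, ortho L y) \<in> \<theta>)"

text \<open>
  There is a monolith, i.e. a least congruence among those different from the identity.
  Congruences are those of the full signature, including the orthocomplementation.
\<close>

definition subdirectly_irreducible :: "('a, 'm) ortho_gorder_scheme \<Rightarrow> bool" where
  "subdirectly_irreducible L \<longleftrightarrow>
     (\<exists>\<mu>. ol_congruence L \<mu> \<and> \<mu> \<noteq> Id_on (carrier L) \<and>
       (\<forall>\<theta>. ol_congruence L \<theta> \<and> \<theta> \<noteq> Id_on (carrier L) \<longrightarrow> \<mu> \<subseteq> \<theta>))"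

text \<open>In a bounded lattice every maximal chain contains both bounds.\<close>

definition infinite_height :: "('a, 'm) gorder_scheme \<Rightarrow> bool" where
  "infinite_height L \<longleftrightarrow> \<not> (\<exists>C. finite C \<and> pred_on.maxchain (carrier L) (le L) C)"

definition ol_subalgebra :: "('a, 'm) ortho_gorder_scheme \<Rightarrow> 'a set \<Rightarrow> bool" where
  "ol_subalgebra L S \<longleftrightarrow>
     S \<subseteq> carrier L \<and> \<bottom>\<^bsub>L\<^esub> \<in> S \<and> \<top>\<^bsub>L\<^esub> \<in> S \<and>
     (\<forall>x\<in>S. \<forall>y\<in>S. x \<squnion>\<^bsub>L\<^esub> y \<in> S \<and> x \<sqinter>\<^bsub>L\<^esub> y \<in> S) \<and>
     (\<forall>x\<in>S. ortho L x \<in> S)"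

definition ol_generated_by :: "('a, 'm) ortho_gorder_scheme \<Rightarrow> 'a set \<Rightarrow> bool" where
  "ol_generated_by L X \<longleftrightarrow> X \<subseteq> carrier L \<and> ol_subalgebra L hull X = carrier L"

text \<open>
  The frame consists of \<open>a i\<close> and \<open>c i j\<close> (written $a_i$ and $a_{ij}$ in the literature) for
  distinct indices in \<open>{1, 2, 3}\<close>; other values of \<open>a\<close> and \<open>c\<close> are irrelevant. As
  \<open>{j, k, l} = {1, 2, 3}\<close>, the join of all \<open>a i\<close> with \<open>i \<noteq> j\<close> is \<open>a k \<squnion> a l\<close>.
\<close>

definition frame_elements :: "(nat \<Rightarrow> 'a) \<Rightarrow> (nat \<Rightarrow> nat \<Rightarrow> 'a) \<Rightarrow> 'a set" where
  "frame_elements a c =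
     {a i | i. i \<in> {1, 2, 3}} \<union> {c i j | i j. i \<in> {1, 2, 3} \<and> j \<in> {1, 2, 3} \<and> i \<noteq> j}"

definition frame3 ::
    "('a, 'm) gorder_scheme \<Rightarrow> (nat \<Rightarrow> 'a) \<Rightarrow> (nat \<Rightarrow> nat \<Rightarrow> 'a) \<Rightarrow> bool" where
  "frame3 L a c \<longleftrightarrow>
     frame_elements a c \<subseteq> carrier L \<and>
     (\<forall>j\<in>{1, 2, 3}. \<forall>k\<in>{1, 2, 3}. \<forall>l\<in>{1, 2, 3}. j \<noteq> k \<and> k \<noteq> l \<and> j \<noteq> l \<longrightarrow>
        a j \<sqinter>\<^bsub>L\<^esub> (a k \<squnion>\<^bsub>L\<^esub> a l) = a 1 \<sqinter>\<^bsub>L\<^esub> a 2 \<sqinter>\<^bsub>L\<^esub> a 3 \<and>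
        a 1 \<sqinter>\<^bsub>L\<^esub> a 2 \<sqinter>\<^bsub>L\<^esub> a 3 = a j \<sqinter>\<^bsub>L\<^esub> c j k \<and>
        a j \<squnion>\<^bsub>L\<^esub> c j k = a j \<squnion>\<^bsub>L\<^esub> a k \<and>
        c j l = c l j \<and>
        c j l = (a j \<squnion>\<^bsub>L\<^esub> a l) \<sqinter>\<^bsub>L\<^esub> (c j k \<squnion>\<^bsub>L\<^esub> c k l))"

definition orthogonal_frame3 ::
    "('a, 'm) ortho_gorder_scheme \<Rightarrow> (nat \<Rightarrow> 'a) \<Rightarrow> (nat \<Rightarrow> nat \<Rightarrow> 'a) \<Rightarrow> bool" where
  "orthogonal_frame3 L a c \<longleftrightarrow>
     frame3 L a c \<and>
     (\<forall>j\<in>{1, 2, 3}. \<forall>k\<in>{1, 2, 3}. j \<noteq> k \<longrightarrow> a j \<sqsubseteq>\<^bsub>L\<^esub> ortho L (a k))"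

end

theory Submission
  imports Defs "HOL-Analysis.Analysis"
begin

text \<open>
  The lattice consists of subspaces \<open>X\<close> of an inner product space with \<open>X + X\<^sup>\<bottom>\<close> the whole space.
  The ranges of the operators of a von Neumann regular ring closed under adjoints form such a
  lattice, because every range is then the range of an orthogonal projection in the ring, and
  regularity survives adding all operators of finite rank.

  On \<open>V\<^sup>3\<close>, with \<open>V\<close> a space of rapidly decreasing sequences, take the frame given by the three axes
  and the graphs of \<open>-alpha\<close> and \<open>-beta\<close>, where \<open>alpha\<close> multiplies the \<open>n\<close>-th entry by \<open>1 / (n + 1)\<close>
  and \<open>beta = 1 + b b\<^sup>*\<close> for some \<open>b\<close> in \<open>V\<close> with positive entries. These operators come from matrices
  over sequences up to finite rank. The frame generates the line of \<open>b\<close>, hence the lines of all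
  \<open>alpha\<^sup>2\<^sup>k b\<close>, which have no nonzero common orthogonal vector and are pairwise non-orthogonal. A
  congruence that collapses some nonzero \<open>X\<close> collapses every line of the lattice not orthogonal
  to \<open>X\<close>, and so collapses the line of \<open>b\<close>. A finite maximal chain would have one-dimensional
  steps, but \<open>V\<close> has infinite dimension.
\<close>

section \<open>Ortholattices of splitting subspaces\<close>

lemma orthogonal_comp_iff: "x \<in> X\<^sup>\<bottom> \<longleftrightarrow> (\<forall>y\<in>X. y \<bullet> x = 0)"
  by (simp add: orthogonal_comp_def orthogonal_def)

lemma subspace_subset_plus1: "subspace Y \<Longrightarrow> X \<subseteq> X + Y"
  by (metis add.right_neutral set_plus_intro subsetI subspace_0)

lemma subspace_subset_plus2: "subspace X \<Longrightarrow> Y \<subseteq> X + Y"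
  by (metis add.left_neutral set_plus_intro subsetI subspace_0)

lemma plus_subset_subspace: "\<lbrakk>subspace Z; X \<subseteq> Z; Y \<subseteq> Z\<rbrakk> \<Longrightarrow> X + Y \<subseteq> Z"
  by (auto simp: set_plus_def subset_iff intro!: subspace_add)

lemma orthogonal_comp_plus:
  assumes "subspace X" "subspace Y"
  shows "(X + Y)\<^sup>\<bottom> = X\<^sup>\<bottom> \<inter> Y\<^sup>\<bottom>"
proof
  show "(X + Y)\<^sup>\<bottom> \<subseteq> X\<^sup>\<bottom> \<inter> Y\<^sup>\<bottom>"
    using assms by (simp add: orthogonal_comp_anti_mono subspace_subset_plus1 subspace_subset_plus2)
  show "X\<^sup>\<bottom> \<inter> Y\<^sup>\<bottom> \<subseteq> (X + Y)\<^sup>\<bottom>"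
    by (auto simp: orthogonal_comp_iff set_plus_def inner_add_left)
qed

lemma orthogonal_comp_Int_self:
  assumes "subspace X"
  shows "X \<inter> X\<^sup>\<bottom> = {0}"
  using assms subspace_0 by (fastforce simp: orthogonal_comp_iff)

text \<open>Without completeness, double complements need the splitting hypothesis. It decomposes
  \<open>z\<close> into \<open>x + y\<close>, and the part \<open>y\<close> turns out to be
  orthogonal to itself.\<close>

lemma orthogonal_comp_orthogonal_comp:
  assumes "subspace X" "X + X\<^sup>\<bottom> = UNIV"
  shows "X\<^sup>\<bottom>\<^sup>\<bottom> = X"
proof
  show "X\<^sup>\<bottom>\<^sup>\<bottom> \<subseteq> X"
  proof
    fix z assume z: "z \<in> X\<^sup>\<bottom>\<^sup>\<bottom>"
    obtain x y where xy: "z = x + y" "x \<in> X" "y \<in> X\<^sup>\<bottom>"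
      using assms(2) by (metis UNIV_I set_plus_elim)
    have "y \<bullet> z = 0" "x \<bullet> y = 0"
      using z xy by (auto simp: orthogonal_comp_iff)
    then have "y = 0"
      by (simp add: xy(1) inner_add_right inner_commute)
    then show "z \<in> X" using xy by simp
  qed
qed (rule orthogonal_comp_subset)

text \<open>The injection \<open>e\<close> transports the whole structure from sets of vectors to
  another type. It is later instantiated with an enumeration of countably many subspaces by natural
  numbers.\<close>

locale split_subspaces =
  fixes \<L> :: "'a::real_inner set set" and e :: "'a set \<Rightarrow> 'b"
  assumes inj: "inj_on e \<L>"
    and subspace: "X \<in> \<L> \<Longrightarrow> subspace X"
    and zero: "{0} \<in> \<L>"
    and comp: "X \<in> \<L> \<Longrightarrow> X\<^sup>\<bottom> \<in> \<L>"
    and plus: "X \<in> \<L> \<Longrightarrow> Y \<in> \<L> \<Longrightarrow> X + Y \<in> \<L>"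
    and split: "X \<in> \<L> \<Longrightarrow> X + X\<^sup>\<bottom> = UNIV"
begin

definition coded_lattice :: "'b ortho_gorder" where
  "coded_lattice = \<lparr>carrier = e ` \<L>, eq = (=),
     le = \<lambda>x y. the_inv_into \<L> e x \<subseteq> the_inv_into \<L> e y,
     ortho = \<lambda>x. e ((the_inv_into \<L> e x)\<^sup>\<bottom>)\<rparr>"

abbreviation "K \<equiv> coded_lattice"

lemma decode: "X \<in> \<L> \<Longrightarrow> the_inv_into \<L> e (e X) = X"
  by (rule the_inv_into_f_f[OF inj])

lemma comp_comp: "X \<in> \<L> \<Longrightarrow> X\<^sup>\<bottom>\<^sup>\<bottom> = X"
  by (simp add: orthogonal_comp_orthogonal_comp subspace split)

lemma UNIV_mem: "UNIV \<in> \<L>"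
  using comp[OF zero] by simp

text \<open>De Morgan's law turns closure under sums and complements into closure under meets;
  double complements cancel because every member splits the space.\<close>

lemma Int_mem:
  assumes "X \<in> \<L>" "Y \<in> \<L>"
  shows "X \<inter> Y \<in> \<L>"
proof -
  have "(X\<^sup>\<bottom> + Y\<^sup>\<bottom>)\<^sup>\<bottom> = X \<inter> Y"
    using assms by (simp add: orthogonal_comp_plus subspace comp comp_comp)
  then show ?thesis
    by (metis assms comp plus)
qed

lemma carrier_K: "carrier K = e ` \<L>"
  and eq_K: "eq K = (=)"
  and le_K: "X \<in> \<L> \<Longrightarrow> Y \<in> \<L> \<Longrightarrow> le K (e X) (e Y) \<longleftrightarrow> X \<subseteq> Y"
  and ortho_K: "X \<in> \<L> \<Longrightarrow> ortho K (e X) = e (X\<^sup>\<bottom>)"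
  by (simp_all add: coded_lattice_def decode)

lemma encode_eq: "X \<in> \<L> \<Longrightarrow> Y \<in> \<L> \<Longrightarrow> e X = e Y \<longleftrightarrow> X = Y"
  using inj by (auto dest: inj_onD)

lemma partial_order_K: "partial_order K"
proof
  show "(.=\<^bsub>K\<^esub>) = (=)" by (simp add: eq_K)
qed (auto simp: eq_K carrier_K le_K)

lemma least_plus:
  assumes "X \<in> \<L>" "Y \<in> \<L>"
  shows "least K (e (X + Y)) (Upper K {e X, e Y})"
proof (rule least_UpperI)
  fix x assume "x \<in> {e X, e Y}"
  then show "x \<sqsubseteq>\<^bsub>K\<^esub> e (X + Y)"
    using assms by (auto simp: le_K plus subspace subspace_subset_plus1 subspace_subset_plus2
        intro: subsetD)
next
  fix y assume y: "y \<in> Upper K {e X, e Y}"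
  then obtain Z where Z: "y = e Z" "Z \<in> \<L>" "X \<subseteq> Z" "Y \<subseteq> Z"
    using assms by (auto simp: Upper_def carrier_K le_K)
  then show "e (X + Y) \<sqsubseteq>\<^bsub>K\<^esub> y"
    using assms by (simp add: le_K plus plus_subset_subspace subspace)
qed (use assms plus in \<open>auto simp: carrier_K\<close>)

lemma greatest_Int:
  assumes "X \<in> \<L>" "Y \<in> \<L>"
  shows "greatest K (e (X \<inter> Y)) (Lower K {e X, e Y})"
proof (rule greatest_LowerI)
  fix y assume y: "y \<in> Lower K {e X, e Y}"
  then obtain Z where Z: "y = e Z" "Z \<in> \<L>" "Z \<subseteq> X" "Z \<subseteq> Y"
    using assms by (auto simp: Lower_def carrier_K le_K)
  then show "y \<sqsubseteq>\<^bsub>K\<^esub> e (X \<inter> Y)"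
    using assms by (simp add: le_K Int_mem)
qed (use assms Int_mem in \<open>auto simp: carrier_K le_K\<close>)

lemma bounded_lattice_K: "bounded_lattice K"
proof -
  interpret partial_order K by (rule partial_order_K)
  show ?thesis
  proof
    fix x y assume "x \<in> carrier K" "y \<in> carrier K"
    then obtain X Y where "x = e X" "y = e Y" "X \<in> \<L>" "Y \<in> \<L>"
      by (auto simp: carrier_K)
    then show "\<exists>s. least K s (Upper K {x, y})" "\<exists>s. greatest K s (Lower K {x, y})"
      using least_plus greatest_Int by blast+
  next
    show "\<exists>x. least K x (carrier K)"
      by (rule exI[of _ "e {0}"])
        (auto simp: least_def carrier_K le_K zero subspace subspace_0)
    show "\<exists>x. greatest K x (carrier K)"
      by (rule exI[of _ "e UNIV"]) (auto simp: greatest_def carrier_K le_K UNIV_mem)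
  qed
qed

sublocale bounded_lattice K
  by (rule bounded_lattice_K)

lemma join_K: "X \<in> \<L> \<Longrightarrow> Y \<in> \<L> \<Longrightarrow> e X \<squnion>\<^bsub>K\<^esub> e Y = e (X + Y)"
  unfolding join_def
  by (rule least_unique[OF sup_of_two_least least_plus]) (auto simp: carrier_K)

lemma meet_K: "X \<in> \<L> \<Longrightarrow> Y \<in> \<L> \<Longrightarrow> e X \<sqinter>\<^bsub>K\<^esub> e Y = e (X \<inter> Y)"
  unfolding meet_def
  by (rule greatest_unique[OF inf_of_two_greatest greatest_Int]) (auto simp: carrier_K)

lemma bottom_K: "\<bottom>\<^bsub>K\<^esub> = e {0}"
  by (rule bottom_eq[symmetric]) (auto simp: carrier_K le_K zero subspace subspace_0)

lemma top_K: "\<top>\<^bsub>K\<^esub> = e UNIV"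
  by (rule top_eq[symmetric]) (auto simp: carrier_K le_K UNIV_mem)

lemma modular_ortholattice_K: "modular_ortholattice K"
proof
  fix x y z
  assume "x \<in> carrier K" "y \<in> carrier K" "z \<in> carrier K" and le: "x \<sqsubseteq>\<^bsub>K\<^esub> z"
  then obtain X Y Z where *: "x = e X" "y = e Y" "z = e Z" "X \<in> \<L>" "Y \<in> \<L>" "Z \<in> \<L>"
    by (auto simp: carrier_K)
  then have "X \<subseteq> Z" using le by (simp add: le_K)
  have "X + (Y \<inter> Z) = (X + Y) \<inter> Z"
  proof
    show "X + (Y \<inter> Z) \<subseteq> (X + Y) \<inter> Z"
      using \<open>X \<subseteq> Z\<close> * by (auto simp: set_plus_def subspace subspace_add subsetD)
    show "(X + Y) \<inter> Z \<subseteq> X + (Y \<inter> Z)"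
    proof
      fix v assume "v \<in> (X + Y) \<inter> Z"
      then obtain a b where "v = a + b" "a \<in> X" "b \<in> Y" "v \<in> Z"
        by (auto elim: set_plus_elim)
      moreover have "b \<in> Z"
        using subspace_diff[OF subspace[OF *(6)] \<open>v \<in> Z\<close>, of a] calculation \<open>X \<subseteq> Z\<close> by auto
      ultimately show "v \<in> X + (Y \<inter> Z)" by auto
    qed
  qed
  then show "x \<squnion>\<^bsub>K\<^esub> y \<sqinter>\<^bsub>K\<^esub> z = (x \<squnion>\<^bsub>K\<^esub> y) \<sqinter>\<^bsub>K\<^esub> z"
    using * by (simp add: join_K meet_K Int_mem plus)
qed (auto simp: carrier_K ortho_K le_K comp comp_comp orthogonal_comp_anti_mono join_K meet_K
    top_K bottom_K split orthogonal_comp_Int_self subspace)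

section \<open>Congruences and the monolith\<close>

text \<open>Congruences are controlled by the class of zero. If \<open>X\<close> and
  \<open>Y\<close> are congruent and \<open>Y\<close> is not contained in \<open>X\<close>, then
  \<open>X\<close> is congruent to \<open>X + Y\<close>, and meeting both with
  \<open>X\<^sup>\<bottom>\<close> identifies zero with the nonzero relative complement of
  \<open>X\<close> in \<open>X + Y\<close>.\<close>

lemma ol_congruence_nontrivial:
  assumes \<theta>: "ol_congruence K \<theta>" and ne: "\<theta> \<noteq> Id_on (carrier K)"
  obtains Z where "Z \<in> \<L>" "Z \<noteq> {0}" "(e {0}, e Z) \<in> \<theta>"
proof -
  have eqv: "equiv (carrier K) \<theta>"
    and ops: "\<And>x y u v. (x, y) \<in> \<theta> \<Longrightarrow> (u, v) \<in> \<theta> \<Longrightarrow>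
      (x \<squnion>\<^bsub>K\<^esub> u, y \<squnion>\<^bsub>K\<^esub> v) \<in> \<theta> \<and> (x \<sqinter>\<^bsub>K\<^esub> u, y \<sqinter>\<^bsub>K\<^esub> v) \<in> \<theta>"
    using \<theta> by (auto simp: ol_congruence_def)
  have refl: "(e X, e X) \<in> \<theta>" if "X \<in> \<L>" for X
    using eqv that by (auto simp: equiv_def refl_on_def carrier_K)
  have sub: "\<theta> \<subseteq> carrier K \<times> carrier K"
    using eqv by (auto simp: equiv_def)
  have "Id_on (carrier K) \<subseteq> \<theta>"
    using refl by (auto simp: carrier_K Id_on_def)
  then obtain x y where "(x, y) \<in> \<theta>" "(x, y) \<notin> Id_on (carrier K)"
    using ne by (metis subrelI subset_antisym)
  then have xy: "(x, y) \<in> \<theta>" "x \<noteq> y" "x \<in> carrier K" "y \<in> carrier K"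
    using sub by (auto simp: Id_on_iff)
  then obtain X Y where "(e X, e Y) \<in> \<theta>" "X \<in> \<L>" "Y \<in> \<L>" "X \<noteq> Y"
    by (auto simp: carrier_K)
  then have "\<exists>X Y. (e X, e Y) \<in> \<theta> \<and> X \<in> \<L> \<and> Y \<in> \<L> \<and> \<not> Y \<subseteq> X"
    using eqv by (metis equivE subset_antisym symE)
  then obtain X Y where XY: "(e X, e Y) \<in> \<theta>" "X \<in> \<L>" "Y \<in> \<L>" "\<not> Y \<subseteq> X"
    by blast
  have XX: "X + X = X"
    using XY(2) plus_subset_subspace[OF subspace, of X X X] subspace_subset_plus1[OF subspace, of X X]
    by auto
  have "(e X, e (X + Y)) \<in> \<theta>"
    using ops[OF refl[OF XY(2)] XY(1)] XY by (simp add: join_K XX)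
  then have "(e {0}, e ((X + Y) \<inter> X\<^sup>\<bottom>)) \<in> \<theta>"
    using ops[OF _ refl[OF comp[OF XY(2)]]] XY
    by (metis comp meet_K orthogonal_comp_Int_self plus subspace)
  moreover have "(X + Y) \<inter> X\<^sup>\<bottom> \<noteq> {0}"
  proof -
    obtain y where y: "y \<in> Y" "y \<notin> X" using XY(4) by auto
    obtain a b where ab: "y = a + b" "a \<in> X" "b \<in> X\<^sup>\<bottom>"
      using split[OF XY(2)] by (metis UNIV_I set_plus_elim)
    have "b = - a + y" using ab by simp
    then have "b \<in> X + Y"
      using y ab XY by (metis set_plus_intro subspace subspace_neg)
    moreover have "b \<noteq> 0" using ab y by auto
    ultimately show ?thesis using ab by auto
  qed
  ultimately show ?thesis
    using that XY comp plus Int_mem by metis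
qed

text \<open>Since \<open>v\<close> is not orthogonal to \<open>Z\<close>, the hyperplane orthogonal
  to \<open>v\<close> together with \<open>Z\<close> spans everything. Collapsing \<open>Z\<close>
  thus identifies the hyperplane with the whole space, and meeting with the line of \<open>v\<close>
  identifies zero with that line.\<close>

lemma ol_congruence_line:
  assumes \<theta>: "ol_congruence K \<theta>" and Z: "Z \<in> \<L>" "(e {0}, e Z) \<in> \<theta>"
    and v: "span {v} \<in> \<L>" and z: "z \<in> Z" "v \<bullet> z \<noteq> 0"
  shows "(e {0}, e (span {v})) \<in> \<theta>"
proof -
  have refl: "(e X, e X) \<in> \<theta>" if "X \<in> \<L>" for X
    using \<theta> that by (auto simp: ol_congruence_def equiv_def refl_on_def carrier_K)
  have ops: "\<And>x y u v. (x, y) \<in> \<theta> \<Longrightarrow> (u, v) \<in> \<theta> \<Longrightarrow>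
      (x \<squnion>\<^bsub>K\<^esub> u, y \<squnion>\<^bsub>K\<^esub> v) \<in> \<theta> \<and> (x \<sqinter>\<^bsub>K\<^esub> u, y \<sqinter>\<^bsub>K\<^esub> v) \<in> \<theta>"
    using \<theta> by (auto simp: ol_congruence_def)
  let ?q = "(span {v})\<^sup>\<bottom>"
  have q: "?q \<in> \<L>" by (rule comp[OF v])
  have "x \<in> Z + ?q" for x
  proof -
    define r where "r = (v \<bullet> x) / (v \<bullet> z)"
    have "v \<bullet> (x - r *\<^sub>R z) = 0"
      using z by (simp add: r_def inner_diff_right)
    then have "x - r *\<^sub>R z \<in> ?q"
      by (auto simp: orthogonal_comp_iff span_singleton)
    then show ?thesis
      using set_plus_intro[of "r *\<^sub>R z" Z "x - r *\<^sub>R z" ?q] z(1) Z(1) subspace subspace_scale by auto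
  qed
  then have "Z + ?q = UNIV" by blast
  moreover have "{0} + ?q = ?q" by (auto simp: set_plus_def)
  ultimately have "(e ?q, e UNIV) \<in> \<theta>"
    using ops[OF Z(2) refl[OF q]] Z q by (simp add: join_K zero)
  from ops[OF this refl[OF v]]
  have "(e (?q \<inter> span {v}), e (span {v})) \<in> \<theta>"
    using v q UNIV_mem by (simp add: meet_K)
  then show ?thesis
    by (metis inf_commute orthogonal_comp_Int_self subspace_span)
qed

text \<open>Every nontrivial congruence collapses some nonzero subspace, hence the line of some
  \<open>v\<close> in \<open>V\<close>, and then each line along a chain of pairwise non-orthogonal
  neighbours ending at \<open>p\<close>. So all nontrivial congruences share one nontrivial
  pair.\<close>

lemma subdirectly_irreducible_K:
  assumes p: "span {p} \<in> \<L>" "p \<noteq> 0"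
    and dense: "\<And>z. z \<noteq> 0 \<Longrightarrow> \<exists>v\<in>V. v \<bullet> z \<noteq> 0"
    and V: "\<And>v. v \<in> V \<Longrightarrow> (v, p) \<in> {(v, w). span {v} \<in> \<L> \<and> span {w} \<in> \<L> \<and> v \<bullet> w \<noteq> 0}\<^sup>*"
    and V_lines: "\<And>v. v \<in> V \<Longrightarrow> span {v} \<in> \<L>"
  shows "subdirectly_irreducible K"
proof -
  let ?c = "\<lambda>\<theta>. ol_congruence K \<theta> \<and> \<theta> \<noteq> Id_on (carrier K)"
  have key: "(e {0}, e (span {p})) \<in> \<theta>" if \<theta>: "?c \<theta>" for \<theta>
  proof -
    obtain Z where Z: "Z \<in> \<L>" "Z \<noteq> {0}" "(e {0}, e Z) \<in> \<theta>"
      using \<theta> ol_congruence_nontrivial by metis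
    then obtain z where z: "z \<in> Z" "z \<noteq> 0"
      using subspace_0[OF subspace] by blast
    then obtain v where v: "v \<in> V" "v \<bullet> z \<noteq> 0" using dense by blast
    have "(e {0}, e (span {v})) \<in> \<theta>"
      using ol_congruence_line[OF conjunct1[OF \<theta>] Z(1,3) V_lines[OF v(1)] z(1) v(2)] .
    with V[OF v(1)] show ?thesis
    proof (induction v rule: converse_rtrancl_induct)
      case base
      then show ?case .
    next
      case (step v w)
      then have v: "span {v} \<in> \<L>" and w: "span {w} \<in> \<L>" "w \<bullet> v \<noteq> 0"
        by (auto simp: inner_commute)
      have "(e {0}, e (span {w})) \<in> \<theta>"
        using ol_congruence_line[OF conjunct1[OF \<theta>] v step.prems w(1) _ w(2)]
        by (simp add: span_base)
      then show ?case by (rule step.IH)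
    qed
  qed
  \<comment> \<open>The monolith is the intersection of all nontrivial congruences. The carrier
    conditions keep it a relation on the carrier even if the quantifier over congruences were
    vacuous.\<close>
  define \<mu> where "\<mu> = {(x, y). x \<in> carrier K \<and> y \<in> carrier K \<and> (\<forall>\<theta>. ?c \<theta> \<longrightarrow> (x, y) \<in> \<theta>)}"
  have \<mu>: "(x, y) \<in> \<mu> \<longleftrightarrow> x \<in> carrier K \<and> y \<in> carrier K \<and> (\<forall>\<theta>. ?c \<theta> \<longrightarrow> (x, y) \<in> \<theta>)" for x y
    by (simp add: \<mu>_def)
  have ortho_cl: "ortho K x \<in> carrier K" if "x \<in> carrier K" for x
    using that by (auto simp: carrier_K ortho_K comp)
  have "ol_congruence K \<mu>"
  proof (intro ol_congruence_def[THEN iffD2] conjI allI impI)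
    have c: "refl_on (carrier K) \<theta>" "sym \<theta>" "trans \<theta>" if "?c \<theta>" for \<theta>
      using that by (simp_all add: ol_congruence_def equiv_def)
    show "equiv (carrier K) \<mu>"
    proof (rule equivI)
      show "\<mu> \<subseteq> carrier K \<times> carrier K"
        by (auto simp: \<mu>_def)
      show "refl_on (carrier K) \<mu>"
        using c(1) by (simp add: refl_on_def \<mu>)
      show "sym \<mu>"
        using c(2) unfolding sym_def \<mu> by blast
      show "trans \<mu>"
        using c(3) unfolding trans_def \<mu> by blast
    qed
  next
    fix x y u v assume "(x, y) \<in> \<mu>" "(u, v) \<in> \<mu>"
    then show "(x \<squnion>\<^bsub>K\<^esub> u, y \<squnion>\<^bsub>K\<^esub> v) \<in> \<mu>" "(x \<sqinter>\<^bsub>K\<^esub> u, y \<sqinter>\<^bsub>K\<^esub> v) \<in> \<mu>"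
      by (simp_all add: \<mu>) (simp_all add: ol_congruence_def)
  next
    fix x y assume "(x, y) \<in> \<mu>"
    then show "(ortho K x, ortho K y) \<in> \<mu>"
      by (simp add: \<mu> ortho_cl) (simp add: ol_congruence_def)
  qed
  moreover have "(e {0}, e (span {p})) \<in> \<mu>"
    using key p zero by (simp add: \<mu> carrier_K)
  moreover have "(e {0}, e (span {p})) \<notin> Id_on (carrier K)"
  proof -
    have "span {p} \<noteq> {0}" using p(2) by (metis insertI1 singletonD span_base)
    then show ?thesis using p(1) zero by (auto simp: encode_eq)
  qed
  moreover have "\<mu> \<subseteq> \<theta>" if "?c \<theta>" for \<theta>
    using that by (auto simp: \<mu>_def)
  ultimately show ?thesis
    unfolding subdirectly_irreducible_def by blast
qed

text \<open>In a finite maximal chain there would be a largest finite-dimensional member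
  \<open>X\<close> and a smallest infinite-dimensional member \<open>Y\<close>. The relative
  complement of \<open>X\<close> in \<open>Y\<close> is infinite-dimensional, and cutting it with a
  hyperplane of the lattice yields a member strictly between \<open>X\<close> and
  \<open>Y\<close>.\<close>

lemma infinite_height_K:
  assumes dense: "\<And>z. z \<noteq> 0 \<Longrightarrow> \<exists>v. span {v} \<in> \<L> \<and> v \<bullet> z \<noteq> 0"
    and inf: "\<And>B. finite B \<Longrightarrow> span B \<noteq> (UNIV :: 'a set)"
  shows "infinite_height K"
  unfolding infinite_height_def
proof
  assume "\<exists>C. finite C \<and> pred_on.maxchain (carrier K) (\<sqsubseteq>\<^bsub>K\<^esub>) C"
  then obtain C0 where fin0: "finite C0" and mc: "pred_on.maxchain (carrier K) (\<sqsubseteq>\<^bsub>K\<^esub>) C0"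
    by blast
  define C where "C = the_inv_into \<L> e ` C0"
  have C0: "C0 \<subseteq> e ` \<L>"
    using mc by (auto simp: pred_on.maxchain_def pred_on.chain_def carrier_K)
  then have "e (the_inv_into \<L> e x) = x" if "x \<in> C0" for x
    using that by (auto intro: f_the_inv_into_f[OF inj])
  then have C0_eq: "C0 = e ` C"
    by (simp add: C_def image_image cong: image_cong)
  have CL: "C \<subseteq> \<L>"
    using C0 by (auto simp: C_def decode)
  have fin: "finite C" using fin0 by (simp add: C_def)
  have chain0: "(\<sqsubseteq>\<^bsub>K\<^esub>)\<^sup>=\<^sup>= x y \<or> (\<sqsubseteq>\<^bsub>K\<^esub>)\<^sup>=\<^sup>= y x" if "x \<in> C0" "y \<in> C0" for x y
    using mc that unfolding pred_on.maxchain_def pred_on.chain_def by (elim conjE) (drule (1) bspec)+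
  have chain: "X \<subseteq> Y \<or> Y \<subseteq> X" if "X \<in> C" "Y \<in> C" for X Y
  proof -
    have "e X \<in> C0" "e Y \<in> C0" using that C0_eq by auto
    then have "e X \<sqsubseteq>\<^bsub>K\<^esub> e Y \<or> e Y \<sqsubseteq>\<^bsub>K\<^esub> e X \<or> e X = e Y"
      using chain0[of "e X" "e Y"] by auto
    moreover have "X \<in> \<L>" "Y \<in> \<L>" using that CL by auto
    ultimately show ?thesis by (auto simp only: le_K encode_eq)
  qed
  have maximal: "W \<in> C" if W: "W \<in> \<L>" and cmp: "\<And>X. X \<in> C \<Longrightarrow> X \<subseteq> W \<or> W \<subseteq> X" for W
  proof (rule ccontr)
    assume "W \<notin> C"
    then have "C0 \<subset> insert (e W) C0"
      using W CL C0_eq encode_eq by blast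
    moreover have "pred_on.chain (carrier K) (\<sqsubseteq>\<^bsub>K\<^esub>) (insert (e W) C0)"
      unfolding pred_on.chain_def
    proof (intro conjI ballI)
      show "insert (e W) C0 \<subseteq> carrier K"
        using W CL by (auto simp: C0_eq carrier_K)
      fix x y assume "x \<in> insert (e W) C0" "y \<in> insert (e W) C0"
      then obtain X Y where "x = e X" "y = e Y" "X \<in> insert W C" "Y \<in> insert W C"
        by (auto simp: C0_eq)
      moreover from this have "X \<in> \<L>" "Y \<in> \<L>" using W CL by auto
      moreover have "X \<subseteq> Y \<or> Y \<subseteq> X"
        using calculation(3,4) cmp chain by (metis insertE order_refl)
      ultimately show "(\<sqsubseteq>\<^bsub>K\<^esub>)\<^sup>=\<^sup>= x y \<or> (\<sqsubseteq>\<^bsub>K\<^esub>)\<^sup>=\<^sup>= y x"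
        by (elim disjE) (simp_all add: le_K)
    qed
    ultimately show False
      using mc unfolding pred_on.maxchain_def by blast
  qed
  \<comment> \<open>Finite dimension, expressed as containment in the span of a finite set.\<close>
  let ?fd = "\<lambda>X :: 'a set. \<exists>B. finite B \<and> X \<subseteq> span B"
  have sub_total: "\<exists>M\<in>S. \<forall>X\<in>S. X \<subseteq> M" "\<exists>M\<in>S. \<forall>X\<in>S. M \<subseteq> X" if "S \<subseteq> C" "S \<noteq> {}" for S
  proof -
    have fS: "finite S" using that fin finite_subset by blast
    have cS: "\<And>X Y. X \<in> S \<Longrightarrow> Y \<in> S \<Longrightarrow> X \<subseteq> Y \<or> Y \<subseteq> X" using that chain by blast
    show "\<exists>M\<in>S. \<forall>X\<in>S. X \<subseteq> M"
      using finite_has_maximal[OF fS that(2)] cS by (metis order_refl)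
    show "\<exists>M\<in>S. \<forall>X\<in>S. M \<subseteq> X"
      using finite_has_minimal[OF fS that(2)] cS by (metis order_refl)
  qed
  have 0: "{0} \<in> C"
    by (rule maximal[OF zero]) (use CL subspace subspace_0 in blast)
  have 1: "UNIV \<in> C"
    by (rule maximal[OF UNIV_mem]) auto
  have "?fd {0}" by (intro exI[of _ "{}"]) auto
  with 0 have "{X \<in> C. ?fd X} \<noteq> {}" by blast
  from sub_total(1)[OF _ this] obtain X where X: "X \<in> C" "?fd X"
    and Xmax: "\<And>Y. Y \<in> C \<Longrightarrow> ?fd Y \<Longrightarrow> Y \<subseteq> X"
    by auto
  have "\<not> ?fd UNIV" by (meson inf subset_UNIV subset_antisym)
  with 1 have "{X \<in> C. \<not> ?fd X} \<noteq> {}" by blast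
  from sub_total(2)[OF _ this] obtain Y where Y: "Y \<in> C" "\<not> ?fd Y"
    and Ymin: "\<And>X. X \<in> C \<Longrightarrow> \<not> ?fd X \<Longrightarrow> Y \<subseteq> X"
    by auto
  have XL: "X \<in> \<L>" and YL: "Y \<in> \<L>" using X Y CL by auto
  have XY: "X \<subseteq> Y"
    using chain[OF X(1) Y(1)] X(2) Y(2) by blast
  define Z where "Z = Y \<inter> X\<^sup>\<bottom>"
  have ZL: "Z \<in> \<L>" using XL YL by (simp add: Z_def comp Int_mem)
  have Y_eq: "y \<in> X + Z" if "y \<in> Y" for y
  proof -
    obtain a b where ab: "y = a + b" "a \<in> X" "b \<in> X\<^sup>\<bottom>"
      using split[OF XL] by (metis UNIV_I set_plus_elim)
    have "b = y - a" using ab by simp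
    moreover have "y - a \<in> Y"
      using ab(2) XY that subspace_diff[OF subspace[OF YL]] by blast
    ultimately have "b \<in> Z" using ab(3) by (simp add: Z_def)
    then show ?thesis using ab by auto
  qed
  have Znfd: "\<not> ?fd Z"
  proof
    assume "?fd Z"
    then obtain B where B: "finite B" "Z \<subseteq> span B" by blast
    obtain B' where B': "finite B'" "X \<subseteq> span B'" using X by blast
    have "Y \<subseteq> span (B' \<union> B)"
    proof
      fix y assume "y \<in> Y"
      then obtain a b where "y = a + b" "a \<in> X" "b \<in> Z" using Y_eq by (metis set_plus_elim)
      then show "y \<in> span (B' \<union> B)"
        using B B' by (metis Un_upper1 Un_upper2 span_add span_mono subsetD)
    qed
    then show False using Y(2) B B' by blast
  qed
  then have "Z \<noteq> {0}" using \<open>?fd {0}\<close> by blast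
  then obtain z where z: "z \<in> Z" "z \<noteq> 0"
    using subspace_0[OF subspace[OF ZL]] by blast
  then obtain v where v: "span {v} \<in> \<L>" "v \<bullet> z \<noteq> 0" using dense by blast
  \<comment> \<open>The hyperplane section of \<open>Z\<close>; it omits \<open>z\<close>, because
    \<open>v\<close> is not orthogonal to \<open>z\<close>.\<close>
  define Q where "Q = Z \<inter> (span {v})\<^sup>\<bottom>"
  have QL: "Q \<in> \<L>" using ZL v by (simp add: Q_def comp Int_mem)
  have Q_iff: "u \<in> Q \<longleftrightarrow> u \<in> Z \<and> v \<bullet> u = 0" for u
    by (auto simp: Q_def orthogonal_comp_iff span_singleton)
  define W where "W = X + Q"
  have WL: "W \<in> \<L>" using XL QL by (simp add: W_def plus)
  have XW: "X \<subseteq> W" using QL by (simp add: W_def subspace subspace_subset_plus1)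
  have WY: "W \<subseteq> Y"
    unfolding W_def using YL XY by (intro plus_subset_subspace) (auto simp: subspace Q_def Z_def)
  have "W \<in> C"
  proof (rule maximal[OF WL])
    fix U assume "U \<in> C"
    then show "U \<subseteq> W \<or> W \<subseteq> U"
      using Xmax[of U] Ymin[of U] XW WY by (meson order_trans)
  qed
  have "X \<inter> Z = {0}"
    using orthogonal_comp_Int_self[OF subspace[OF XL]] subspace_0[OF subspace[OF XL]]
      subspace_0[OF subspace[OF ZL]] unfolding Z_def by blast
  \<comment> \<open>\<open>W\<close> belongs to the chain, so it is \<open>X\<close> or
    \<open>Y\<close>. In the first case \<open>Q\<close> is zero and \<open>Z\<close> is at most a
    line; in the second case \<open>z\<close> lies in \<open>W\<close>, which forces it into
    \<open>Q\<close>.\<close>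
  show False
  proof (cases "?fd W")
    case True
    then have "W = X" using Xmax[OF \<open>W \<in> C\<close>] XW by blast
    then have "Q \<subseteq> X" using XL by (simp add: W_def) (metis subspace subspace_subset_plus2)
    then have Q0: "\<And>u. u \<in> Q \<Longrightarrow> u = 0" using \<open>X \<inter> Z = {0}\<close> Q_iff by blast
    have "Z \<subseteq> span {z}"
    proof
      fix u assume u: "u \<in> Z"
      let ?r = "(v \<bullet> u) / (v \<bullet> z)"
      have "u - ?r *\<^sub>R z \<in> Q"
        unfolding Q_iff using v z u subspace[OF ZL]
        by (simp add: inner_diff_right subspace_diff subspace_scale)
      then have "u = ?r *\<^sub>R z" using Q0 by fastforce
      then show "u \<in> span {z}" by (metis insertI1 span_base span_scale)
    qed
    then show False using Znfd by blast
  next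
    case False
    then have "Y \<subseteq> W" using Ymin[OF \<open>W \<in> C\<close>] by blast
    moreover have "z \<in> Y" using z by (simp add: Z_def)
    ultimately obtain a b where ab: "z = a + b" "a \<in> X" "b \<in> Q"
      unfolding W_def by (metis set_plus_elim subsetD)
    have "a = z - b" using ab by simp
    moreover have "z - b \<in> Z"
      using ab z(1) Q_iff subspace_diff[OF subspace[OF ZL]] by blast
    ultimately have "a \<in> Z" by simp
    then have "a = 0" using ab \<open>X \<inter> Z = {0}\<close> by blast
    then show False using ab v Q_iff by simp
  qed
qed

end

section \<open>Regular rings of operators\<close>

text \<open>A relation rather than a function, since an operator on an incomplete space may have no
  adjoint.\<close>

definition adjoint_pair :: "('a::real_inner \<Rightarrow> 'a) \<Rightarrow> ('a \<Rightarrow> 'a) \<Rightarrow> bool" where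
  "adjoint_pair T T' \<longleftrightarrow> (\<forall>x y. T x \<bullet> y = x \<bullet> T' y)"

lemma adjoint_pair_sym: "adjoint_pair T T' \<Longrightarrow> adjoint_pair T' T"
  by (simp add: adjoint_pair_def) (metis inner_commute)

locale star_regular_operators =
  fixes S :: "('a::real_inner \<Rightarrow> 'a) set"
  assumes linear: "T \<in> S \<Longrightarrow> linear T"
    and id: "id \<in> S"
    and add: "T \<in> S \<Longrightarrow> U \<in> S \<Longrightarrow> (\<lambda>x. T x + U x) \<in> S"
    and diff: "T \<in> S \<Longrightarrow> U \<in> S \<Longrightarrow> (\<lambda>x. T x - U x) \<in> S"
    and comp: "T \<in> S \<Longrightarrow> U \<in> S \<Longrightarrow> T \<circ> U \<in> S"
    and adjoint: "T \<in> S \<Longrightarrow> \<exists>T'\<in>S. adjoint_pair T T'"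
    and regular: "T \<in> S \<Longrightarrow> \<exists>G\<in>S. \<forall>x. T (G (T x)) = T x"
begin

text \<open>
  If \<open>G\<close> is a quasi-inverse of \<open>T\<^sup>* T\<close>, then \<open>T G T\<^sup>*\<close> is the orthogonal projection onto the range
  of \<open>T\<close>.
\<close>

lemma range_projection:
  assumes T: "T \<in> S"
  obtains P where "P \<in> S" "adjoint_pair P P" "\<And>x. P (P x) = P x" "range P = range T"
proof -
  obtain T' where T': "T' \<in> S" "adjoint_pair T T'" using adjoint[OF T] by blast
  have adj: "T x \<bullet> y = x \<bullet> T' y" for x y using T'(2) by (simp add: adjoint_pair_def)
  obtain G where G: "G \<in> S" "\<And>x. T' (T (G (T' (T x)))) = T' (T x)"
    using regular[OF comp[OF T'(1) T]] by auto
  obtain G' where G': "G' \<in> S" "adjoint_pair G G'" using adjoint[OF G(1)] by blast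
  have adjG: "G x \<bullet> y = x \<bullet> G' y" for x y using G'(2) by (simp add: adjoint_pair_def)
  define P where "P = T \<circ> G \<circ> T'"
  have P: "P \<in> S" unfolding P_def using T T' G comp by blast
  \<comment> \<open>The defect \<open>?N\<close> lies in the range of \<open>T\<close> and is killed
    by \<open>T'\<close>, so it is orthogonal to itself.\<close>
  have PT: "P (T x) = T x" for x
  proof -
    let ?N = "T (G (T' (T x)) - x)"
    have "?N \<bullet> ?N = (G (T' (T x)) - x) \<bullet> (T' ?N)" by (rule adj)
    also have "T' ?N = 0"
      using G(2) by (simp add: linear_diff linear[OF T] linear[OF T'(1)])
    finally show ?thesis by (simp add: P_def linear_diff linear[OF T])
  qed
  have adjP: "P x \<bullet> y = x \<bullet> T (G' (T' y))" for x y
    by (simp add: P_def adj adjG) (metis adj inner_commute)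
  \<comment> \<open>The adjoint of \<open>P\<close> takes values in the range of \<open>T\<close>,
    where \<open>P\<close> is the identity. This rewrites \<open>P x \<bullet> y\<close> in a form
    symmetric in \<open>x\<close> and \<open>y\<close>, whence \<open>P\<close> is
    self-adjoint.\<close>
  have "P x \<bullet> y = T (G' (T' x)) \<bullet> T (G' (T' y))" for x y
    using adjP[of x y] adjP[of "T (G' (T' y))" x] by (simp add: PT inner_commute)
  then have "P x \<bullet> y = x \<bullet> P y" for x y
    by (metis inner_commute)
  then have "adjoint_pair P P" by (simp add: adjoint_pair_def)
  moreover have "P (P x) = P x" for x using PT by (simp add: P_def)
  moreover have "range P = range T"
    using PT by (auto simp: P_def) (metis rangeI)
  ultimately show ?thesis using that P by blast
qed


definition ranges :: "'a set set" where
  "ranges = range ` S"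

lemma ranges_zero: "{0} \<in> ranges"
proof -
  have "(\<lambda>x. 0) \<in> S" using diff[OF id id] by simp
  moreover have "range (\<lambda>x::'a. 0::'a) = {0}" by auto
  ultimately show ?thesis
    unfolding ranges_def by (intro image_eqI[of _ _ "\<lambda>x. 0"]) simp_all
qed

lemma ranges_subspace: "X \<in> ranges \<Longrightarrow> subspace X"
  using linear by (auto simp: ranges_def intro: linear_subspace_image)

lemma ranges_projection:
  assumes "X \<in> ranges"
  obtains P where "P \<in> S" "\<And>x y. P x \<bullet> y = x \<bullet> P y" "\<And>x. P (P x) = P x" "X = range P"
  using assms range_projection unfolding ranges_def adjoint_pair_def by (smt (verit) imageE)

lemma ranges_comp_split:
  assumes "X \<in> ranges"
  shows "X\<^sup>\<bottom> \<in> ranges" "X + X\<^sup>\<bottom> = UNIV"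
proof -
  obtain P where P: "P \<in> S" "\<And>x y. P x \<bullet> y = x \<bullet> P y" "\<And>x. P (P x) = P x" "X = range P"
    using ranges_projection[OF assms] by metis
  have perp: "x - P x \<in> X\<^sup>\<bottom>" for x
    by (simp add: orthogonal_comp_iff P(2-4) inner_diff_right)
  have perp_eq: "x \<in> X\<^sup>\<bottom> \<Longrightarrow> P x = 0" for x
    using P by (simp add: orthogonal_comp_iff) (metis inner_eq_zero_iff)
  have "range (\<lambda>x. x - P x) = X\<^sup>\<bottom>"
  proof
    show "X\<^sup>\<bottom> \<subseteq> range (\<lambda>x. x - P x)"
    proof
      fix x assume "x \<in> X\<^sup>\<bottom>"
      then show "x \<in> range (\<lambda>x. x - P x)"
        by (intro image_eqI[of _ _ x]) (simp_all add: perp_eq)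
    qed
  qed (use perp in auto)
  moreover have "(\<lambda>x. x - P x) \<in> S" using diff[OF id P(1)] by simp
  ultimately show "X\<^sup>\<bottom> \<in> ranges"
    unfolding ranges_def by (intro image_eqI[of _ _ "\<lambda>x. x - P x"]) simp_all
  have "x \<in> X + X\<^sup>\<bottom>" for x
    using set_plus_intro[of "P x" X "x - P x"] perp P(4) by auto
  then show "X + X\<^sup>\<bottom> = UNIV" by blast
qed

text \<open>Replacing \<open>Q\<close> by \<open>U\<close>, the part of \<open>Q\<close> orthogonal
  to \<open>X\<close>, leaves the sum of the ranges unchanged. The projection \<open>R\<close> onto
  the range of \<open>U\<close> satisfies \<open>P R = R P = 0\<close>, so the range of
  \<open>P + R\<close> is the full sum \<open>X + Y\<close>.\<close>

lemma ranges_plus: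
  assumes "X \<in> ranges" "Y \<in> ranges"
  shows "X + Y \<in> ranges"
proof -
  obtain P where P: "P \<in> S" "\<And>x y. P x \<bullet> y = x \<bullet> P y" "\<And>x. P (P x) = P x" "X = range P"
    using ranges_projection[OF assms(1)] by metis
  obtain Q where Q: "Q \<in> S" "\<And>x. Q (Q x) = Q x" "Y = range Q"
    using ranges_projection[OF assms(2)] by metis
  define U where "U = (\<lambda>x. Q x - P (Q x))"
  have "U \<in> S" using diff[OF Q(1) comp[OF P(1) Q(1)]] by (simp add: U_def)
  then obtain R where R: "R \<in> S" "\<And>x y. R x \<bullet> y = x \<bullet> R y" "\<And>x. R (R x) = R x" "range R = range U"
    using range_projection unfolding adjoint_pair_def by metis
  have "P (U x) = 0" for x
    by (simp add: U_def linear_diff[OF linear[OF P(1)]] P(3))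
  then have PR: "P (R x) = 0" for x using R(4) by (metis rangeE rangeI)
  have RP: "R (P x) = 0" for x
  proof -
    have "R (P x) \<bullet> R (P x) = P x \<bullet> R (R (P x))" by (rule R(2))
    also have "\<dots> = x \<bullet> P (R (P x))" unfolding R(3) by (rule P(2))
    finally show ?thesis by (simp add: PR)
  qed
  have "range (\<lambda>x. P x + R x) = X + Y"
  proof
    have "P x + R x \<in> X + Y" for x
    proof -
      obtain y where "R x = Q y - P (Q y)" using R(4) by (metis U_def rangeE rangeI)
      then have "P x + R x = P (x - Q y) + Q y" by (simp add: linear_diff[OF linear[OF P(1)]])
      then show ?thesis using P(4) Q(3) by auto
    qed
    then show "range (\<lambda>x. P x + R x) \<subseteq> X + Y" by auto
    show "X + Y \<subseteq> range (\<lambda>x. P x + R x)"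
    proof
      fix v assume "v \<in> X + Y"
      then obtain x y where v: "v = P x + Q y" using P(4) Q(3) by (auto elim: set_plus_elim)
      obtain z where z: "U y = R z" using R(4) by (metis rangeE rangeI)
      have "v = P (x + Q y) + R z"
        using z by (simp add: v U_def linear_add[OF linear[OF P(1)]] algebra_simps)
      also have "\<dots> = P (P (x + Q y) + R z) + R (P (x + Q y) + R z)"
        by (simp add: linear_add[OF linear[OF P(1)]] linear_add[OF linear[OF R(1)]] PR RP P(3) R(3))
      finally show "v \<in> range (\<lambda>x. P x + R x)" by blast
    qed
  qed
  then show ?thesis
    using add[OF P(1) R(1)] unfolding ranges_def
    by (intro image_eqI[of _ _ "\<lambda>x. P x + R x"]) simp_all
qed

end

section \<open>Operators of finite rank\<close>

text \<open>The number counts rank-one summands and so only bounds the rank from above. The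
  functionals are inner products with vectors of the space, which guarantees adjoints.\<close>

inductive finite_rank :: "nat \<Rightarrow> ('a::real_inner \<Rightarrow> 'a) \<Rightarrow> bool" where
  zero: "finite_rank 0 (\<lambda>x. 0)"
| Suc: "finite_rank n N \<Longrightarrow> finite_rank (Suc n) (\<lambda>x. N x + (w \<bullet> x) *\<^sub>R u)"

lemma finite_rank_linear: "finite_rank n N \<Longrightarrow> linear N"
proof (induction rule: finite_rank.induct)
  case (Suc n N w u)
  show ?case
    by (rule linearI) (simp_all add: linear_add[OF Suc.IH] linear_scale[OF Suc.IH] inner_add_right
        scaleR_add_left scaleR_add_right)
qed (simp add: linear_zero)

lemma finite_rank_comp_left:
  assumes "finite_rank n N" "linear T"
  shows "finite_rank n (\<lambda>x. T (N x))"
  using assms(1)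
proof (induction rule: finite_rank.induct)
  case zero
  then show ?case using finite_rank.zero assms(2) by (simp add: linear_0)
next
  case (Suc n N w u)
  then show ?case
    using finite_rank.Suc[OF Suc.IH, of w "T u"] assms(2) by (simp add: linear_add linear_scale)
qed

lemma finite_rank_comp_right:
  assumes "finite_rank n N" "adjoint_pair T T'"
  shows "finite_rank n (\<lambda>x. N (T x))"
  using assms(1)
proof (induction rule: finite_rank.induct)
  case (Suc n N w u)
  then show ?case
    using finite_rank.Suc[OF Suc.IH, of "T' w" u] adjoint_pair_sym[OF assms(2)]
    by (simp add: adjoint_pair_def)
qed (rule finite_rank.zero)

lemma finite_rank_add:
  assumes "finite_rank m M" "finite_rank n N"
  shows "finite_rank (m + n) (\<lambda>x. M x + N x)"
  using assms(2)
proof (induction rule: finite_rank.induct)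
  case (Suc n N w u)
  then show ?case using finite_rank.Suc[OF Suc.IH, of w u] by (simp add: add.assoc)
qed (use assms(1) in simp)

lemma finite_rank_rank_one: "finite_rank 1 (\<lambda>x. (w \<bullet> x) *\<^sub>R u)"
  using finite_rank.Suc[OF finite_rank.zero, of w u] by simp

lemma finite_rank_diff:
  "finite_rank m M \<Longrightarrow> finite_rank n N \<Longrightarrow> finite_rank (m + n) (\<lambda>x. M x - N x)"
  using finite_rank_add[OF _ finite_rank_comp_left[OF _ linear_uminus], of m M n N] by simp

lemma finite_rank_adjoint:
  "finite_rank n N \<Longrightarrow> \<exists>N'. finite_rank n N' \<and> adjoint_pair N N'"
proof (induction rule: finite_rank.induct)
  case zero
  then show ?case
    by (intro exI[of _ "\<lambda>x. 0"]) (simp add: finite_rank.zero adjoint_pair_def)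
next
  case (Suc n N w u)
  then obtain N' where "finite_rank n N'" "adjoint_pair N N'" by blast
  then show ?case
    by (intro exI[of _ "\<lambda>x. N' x + (u \<bullet> x) *\<^sub>R w"] conjI finite_rank.Suc)
      (simp_all add: adjoint_pair_def inner_add_left inner_add_right inner_commute)
qed

text \<open>The ring identity behind regularity of extensions: if \<open>Z\<close> is a
  quasi-inverse of the defect \<open>T - T Y T\<close>, then
  \<open>Y + (1 - Y T) Z (1 - T Y)\<close> is a quasi-inverse of \<open>T\<close>.\<close>

lemma quasi_inverse_lift:
  assumes "linear T" "linear Y" "linear Z"
    and "\<And>x. N x = T x - T (Y (T x))" "\<And>x. N (Z (N x)) = N x"
  shows "T (Y (T x) + (Z (T x - T (Y (T x))) - Y (T (Z (T x - T (Y (T x))))))) = T x"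
  using assms(5)[of x] by (simp add: assms(4) linear_add linear_diff assms(1-3))

text \<open>Induction on the number of rank-one summands. One summand is made orthogonal to the rest
  and inverted explicitly; the remaining defect has one summand fewer, and
  \<open>quasi_inverse_lift\<close> combines the two quasi-inverses.\<close>

lemma finite_rank_regular:
  "finite_rank n N \<Longrightarrow> \<exists>m Y. finite_rank m Y \<and> (\<forall>x. N (Y (N x)) = N x)"
proof (induction n arbitrary: N)
  case 0
  then show ?case
    by (auto elim!: finite_rank.cases intro!: exI[of _ "0::nat"] exI[of _ "\<lambda>x. 0"] finite_rank.zero)
next
  case (Suc n)
  from Suc.prems obtain N0 w u where N0: "finite_rank n N0" and N: "N = (\<lambda>x. N0 x + (w \<bullet> x) *\<^sub>R u)"
    by (auto elim: finite_rank.cases)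
  note lin0 = finite_rank_linear[OF N0]
  note linN = finite_rank_linear[OF Suc.prems]
  show ?case
  proof (cases "u = 0")
    case True
    then show ?thesis using Suc.IH N0 N by simp
  next
    case False
    then have uu: "u \<bullet> u \<noteq> 0" by simp
    obtain N0' where N0': "adjoint_pair N0 N0'" using finite_rank_adjoint[OF N0] by blast
    \<comment> \<open>The component of \<open>N0 x\<close> along \<open>u\<close> is absorbed into
      the functional, so that the range of \<open>N1\<close> becomes orthogonal to
      \<open>u\<close>.\<close>
    define w' where "w' = w + (1 / (u \<bullet> u)) *\<^sub>R N0' u"
    define N1 where "N1 = (\<lambda>x. N0 x - (u \<bullet> N0 x / (u \<bullet> u)) *\<^sub>R u)"
    have linP: "linear (\<lambda>x. x - (v \<bullet> x / (v \<bullet> v)) *\<^sub>R v)" for v :: 'a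
      by (rule linearI)
        (simp_all add: inner_add_right add_divide_distrib scaleR_add_left scaleR_diff_right)
    have N1: "finite_rank n N1"
      using finite_rank_comp_left[OF N0 linP[of u]] by (simp add: N1_def)
    have w'x: "w' \<bullet> x = w \<bullet> x + u \<bullet> N0 x / (u \<bullet> u)" for x
      using adjoint_pair_sym[OF N0'] by (simp add: w'_def adjoint_pair_def inner_add_left)
    have N_eq: "N x = N1 x + (w' \<bullet> x) *\<^sub>R u" for x
      by (simp add: N N1_def w'x algebra_simps)
    have u_N: "u \<bullet> N x = (w' \<bullet> x) * (u \<bullet> u)" for x
      using uu by (simp add: N_eq N1_def inner_add_right inner_diff_right)
    show ?thesis
    proof (cases "w' = 0")
      case True
      then have "N = N1" by (simp add: N_eq fun_eq_iff)
      then show ?thesis using Suc.IH[OF N1] by simp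
    next
      case False
      then have ww: "w' \<bullet> w' \<noteq> 0" by simp
      \<comment> \<open>The Moore-Penrose inverse of the rank-one part; it vanishes on the range of
        \<open>N1\<close>.\<close>
      define Y where "Y = (\<lambda>x. (u \<bullet> x) *\<^sub>R ((1 / ((w' \<bullet> w') * (u \<bullet> u))) *\<^sub>R w'))"
      have Y: "finite_rank 1 Y" unfolding Y_def by (rule finite_rank_rank_one)
      note linY = finite_rank_linear[OF Y]
      define N2 where "N2 = (\<lambda>x. N1 (x - (w' \<bullet> x / (w' \<bullet> w')) *\<^sub>R w'))"
      have "adjoint_pair (\<lambda>x. x - (w' \<bullet> x / (w' \<bullet> w')) *\<^sub>R w') (\<lambda>x. x - (w' \<bullet> x / (w' \<bullet> w')) *\<^sub>R w')"
        by (simp add: adjoint_pair_def inner_diff_left inner_diff_right inner_commute)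
      then have "finite_rank n N2"
        using finite_rank_comp_right[OF N1] by (simp add: N2_def)
      then obtain m Z where Z: "finite_rank m Z" "\<And>x. N2 (Z (N2 x)) = N2 x"
        using Suc.IH by blast
      note linZ = finite_rank_linear[OF Z(1)]
      have YN: "Y (N x) = (w' \<bullet> x / (w' \<bullet> w')) *\<^sub>R w'" for x
        using uu by (simp add: Y_def u_N)
      have N2_eq: "N2 x = N x - N (Y (N x))" for x
      proof -
        have "N x - N (Y (N x)) = N (x - (w' \<bullet> x / (w' \<bullet> w')) *\<^sub>R w')"
          by (simp add: YN linear_diff[OF linN])
        also have "\<dots> = N2 x"
          using ww by (simp add: N_eq N2_def inner_diff_right)
        finally show ?thesis by simp
      qed
      define W where "W = (\<lambda>x. Y x + (Z (x - N (Y x)) - Y (N (Z (x - N (Y x))))))"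
      have R: "finite_rank (m + 1) (\<lambda>x. Z (x - N (Y x)))"
        using finite_rank_diff[OF Z(1)
            finite_rank_comp_left[OF Y linear_compose[OF linN linZ]]]
        by (simp add: linear_diff[OF linZ])
      have "\<exists>m. finite_rank m W"
        unfolding W_def
        using finite_rank_add[OF Y finite_rank_diff[OF R
            finite_rank_comp_left[OF R linear_compose[OF linN linY]]]]
        by auto
      then show ?thesis
        using quasi_inverse_lift[OF linN linY linZ N2_eq Z(2)] by (auto simp: W_def)
    qed
  qed
qed

lemma adjoint_pair_add:
  "adjoint_pair T T' \<Longrightarrow> adjoint_pair U U' \<Longrightarrow> adjoint_pair (\<lambda>x. T x + U x) (\<lambda>x. T' x + U' x)"
  by (simp add: adjoint_pair_def inner_add_left inner_add_right)

definition finite_rank_perturbations :: "('a::real_inner \<Rightarrow> 'a) set \<Rightarrow> ('a \<Rightarrow> 'a) set" where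
  "finite_rank_perturbations S = {\<lambda>x. T x + N x | T N n. T \<in> S \<and> finite_rank n N}"

lemma finite_rank_perturbationsI:
  "\<lbrakk>T \<in> S; finite_rank n N; \<And>x. U x = T x + N x\<rbrakk> \<Longrightarrow> U \<in> finite_rank_perturbations S"
  unfolding finite_rank_perturbations_def by blast

lemma finite_rank_perturbationsE:
  assumes "U \<in> finite_rank_perturbations S"
  obtains T N n where "T \<in> S" "finite_rank n N" "U = (\<lambda>x. T x + N x)"
  using assms unfolding finite_rank_perturbations_def by blast

text \<open>Finite rank operators behave like an ideal that is itself regular. A quasi-inverse
  \<open>G\<close> of the unperturbed part \<open>A\<close> works for \<open>T\<close> up to a
  defect of finite rank, which \<open>quasi_inverse_lift\<close> repairs.\<close>

theorem (in star_regular_operators) star_regular_finite_rank_perturbations: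
  "star_regular_operators (finite_rank_perturbations S)" (is "star_regular_operators ?S")
proof (rule star_regular_operators.intro)
  fix T assume "T \<in> ?S"
  then obtain A M m where A: "A \<in> S" and M: "finite_rank m M" and T: "T = (\<lambda>x. A x + M x)"
    by (rule finite_rank_perturbationsE)
  note linA = linear[OF A] and linM = finite_rank_linear[OF M]
  show linT: "linear T"
    unfolding T by (rule linear_compose_add[OF linA linM])
  obtain A' where A': "A' \<in> S" "adjoint_pair A A'" using adjoint[OF A] by blast
  obtain M' where M': "finite_rank m M'" "adjoint_pair M M'" using finite_rank_adjoint[OF M] by blast
  show adjT: "\<exists>T'\<in>?S. adjoint_pair T T'"
    using finite_rank_perturbationsI[OF A'(1) M'(1) refl] adjoint_pair_add[OF A'(2) M'(2)] T by auto
  {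
    fix U assume "U \<in> ?S"
    then obtain B N n where B: "B \<in> S" and N: "finite_rank n N" and U: "U = (\<lambda>x. B x + N x)"
      by (rule finite_rank_perturbationsE)
    note linB = linear[OF B] and linN = finite_rank_linear[OF N]
    show "(\<lambda>x. T x + U x) \<in> ?S"
      by (rule finite_rank_perturbationsI[OF add[OF A B] finite_rank_add[OF M N]]) (simp add: T U)
    show "(\<lambda>x. T x - U x) \<in> ?S"
      by (rule finite_rank_perturbationsI[OF diff[OF A B] finite_rank_diff[OF M N]]) (simp add: T U)
    obtain B' where "adjoint_pair B B'" using adjoint[OF B] by blast
    then have "finite_rank (n + (m + n)) (\<lambda>x. A (N x) + (M (B x) + M (N x)))"
      by (intro finite_rank_add finite_rank_comp_left[OF N linA] finite_rank_comp_left[OF N linM])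
        (rule finite_rank_comp_right[OF M])
    then show "T \<circ> U \<in> ?S"
      by (rule finite_rank_perturbationsI[OF comp[OF A B]])
        (simp add: T U linear_add[OF linA] linear_add[OF linM] algebra_simps)
  }
  obtain G where G: "G \<in> S" "\<And>x. A (G (A x)) = A x" using regular[OF A] by blast
  note linG = linear[OF G(1)]
  obtain A'' where A'': "adjoint_pair (G \<circ> A) A''" using adjoint[OF comp[OF G(1) A]] by blast
  define D where "D = (\<lambda>x. T x - T (G (T x)))"
  have "\<exists>d. finite_rank d D"
  proof -
    \<comment> \<open>Since \<open>A G A = A\<close>, the terms free of \<open>M\<close> cancel, and
      every remaining term has a factor \<open>M\<close>.\<close>
    have "D x = (M x - A (G (M x))) - (M (G (A x)) + M (G (M x)))" for x
      by (simp add: D_def T linear_add[OF linA] linear_add[OF linM] linear_add[OF linG] G(2))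
    then have D: "D = (\<lambda>x. (M x - A (G (M x))) - (M (G (A x)) + M (G (M x))))" by blast
    have f: "finite_rank m (\<lambda>x. A (G (M x)))" "finite_rank m (\<lambda>x. M (G (M x)))"
      using finite_rank_comp_left[OF M linear_compose[OF linG linA]]
        finite_rank_comp_left[OF M linear_compose[OF linG linM]] by simp_all
    have "finite_rank m (\<lambda>x. M (G (A x)))"
      using finite_rank_comp_right[OF M A''] by simp
    then show ?thesis
      unfolding D using finite_rank_diff[OF finite_rank_diff[OF M f(1)] finite_rank_add[OF _ f(2)]]
      by blast
  qed
  then obtain z Z where Z: "finite_rank z Z" "\<And>x. D (Z (D x)) = D x"
    using finite_rank_regular by blast
  note linZ = finite_rank_linear[OF Z(1)]
  \<comment> \<open>The correction \<open>(1 - G T) Z (1 - T G)\<close> from the lift. An adjoint of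
    \<open>1 - T G\<close> is constructed next because composing on the right preserves finite rank
    only for operators with adjoint.\<close>
  define W where "W = (\<lambda>x. Z (x - T (G x)) - G (T (Z (x - T (G x)))))"
  obtain C where C: "adjoint_pair (\<lambda>x. x - T (G x)) C"
  proof -
    obtain T' where "adjoint_pair T T'" using adjT by blast
    moreover obtain G' where "adjoint_pair G G'" using adjoint[OF G(1)] by blast
    ultimately have "adjoint_pair (\<lambda>x. x - T (G x)) (\<lambda>x. x - G' (T' x))"
      by (simp add: adjoint_pair_def inner_diff_left inner_diff_right)
    then show ?thesis using that by blast
  qed
  have R: "finite_rank z (\<lambda>x. Z (x - T (G x)))"
    by (rule finite_rank_comp_right[OF Z(1) C])
  have "finite_rank (z + z) W"
    unfolding W_def
    using finite_rank_diff[OF R finite_rank_comp_left[OF R linear_compose[OF linT linG]]] by simp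
  then have "(\<lambda>x. G x + W x) \<in> ?S"
    by (rule finite_rank_perturbationsI[OF G(1)]) simp
  moreover have "T (G (T x) + W (T x)) = T x" for x
    unfolding W_def by (rule quasi_inverse_lift[OF linT linG linZ _ Z(2)]) (simp add: D_def)
  ultimately show "\<exists>G\<in>?S. \<forall>x. T (G (T x)) = T x"
    by (intro bexI[of _ "\<lambda>x. G x + W x"]) simp_all
next
  show "id \<in> ?S"
    by (rule finite_rank_perturbationsI[OF id finite_rank.zero]) simp
qed

section \<open>The sequence space\<close>

text \<open>Names for the elements of a countable ring of matrix sequences. A constructor for
  pointwise quasi-inverses builds regularity into the ring, and one for transposes builds in
  adjoints.\<close>

datatype mat_term =
    MOne
  | MUnit 3 3
  | MDiag
  | MAdd mat_term mat_term
  | MDiff mat_term mat_term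
  | MMult mat_term mat_term
  | MTranspose mat_term
  | MQuasiInv mat_term

instance mat_term :: countable
  by countable_datatype

lemma matrix_quasi_inverse: "\<exists>G. A ** G ** A = (A :: real^'n^'m)"
proof -
  obtain g where g: "linear g" "\<And>v. A *v g (A *v v) = A *v v"
    using linear_exists_right_inverse_on[OF matrix_vector_mul_linear subspace_UNIV, of A] by auto
  have "A ** matrix g ** A = A"
    by (simp add: matrix_eq g matrix_works[OF g(1)[folded linear_matrix_vector_mul_eq]] flip: matrix_vector_mul_assoc)
  then show ?thesis ..
qed

definition quasi_inverse :: "real^'n^'m \<Rightarrow> real^'m^'n" where
  "quasi_inverse A = (SOME G. A ** G ** A = A)"

lemma quasi_inverse: "A ** quasi_inverse A ** A = A"
  unfolding quasi_inverse_def by (rule someI_ex[OF matrix_quasi_inverse])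

primrec mat_seq :: "mat_term \<Rightarrow> nat \<Rightarrow> real^3^3" where
  "mat_seq MOne n = mat 1"
| "mat_seq (MUnit i j) n = (\<chi> k l. if k = i \<and> l = j then 1 else 0)"
| "mat_seq MDiag n = mat (1 / (real n + 1))"
| "mat_seq (MAdd X Y) n = mat_seq X n + mat_seq Y n"
| "mat_seq (MDiff X Y) n = mat_seq X n - mat_seq Y n"
| "mat_seq (MMult X Y) n = mat_seq X n ** mat_seq Y n"
| "mat_seq (MTranspose X) n = transpose (mat_seq X n)"
| "mat_seq (MQuasiInv X) n = quasi_inverse (mat_seq X n)"

definition entry :: "mat_term \<Rightarrow> 3 \<Rightarrow> 3 \<Rightarrow> nat \<Rightarrow> real" where
  "entry X i j n = mat_seq X n $ i $ j"

text \<open>A matrix unit between the factors isolates a single product of entries. Hence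
  multiplication by any entry maps the sequence space defined below into itself.\<close>

lemma entry_mult: "\<exists>Z. \<forall>n. entry Z i l n = entry X i j n * entry Y k l n"
proof
  have eq: "(if p \<and> q then (1::real) else 0) * c = (if p then if q then c else 0 else 0)"
    "(if p then d else 0) * c = (if p then d * c else 0)"
    "c * (if p \<and> q then (1::real) else 0) = (if p then if q then c else 0 else 0)" for p q and c d :: real
    by auto
  show "\<forall>n. entry (MMult (MMult X (MUnit j k)) Y) i l n = entry X i j n * entry Y k l n"
    by (simp add: entry_def matrix_matrix_mult_def eq)
qed

section \<open>The inner product space of rapidly decreasing sequences\<close>

lemma summable_square_add:
  fixes f g :: "nat \<Rightarrow> real"
  assumes "summable (\<lambda>n. (f n)\<^sup>2)" "summable (\<lambda>n. (g n)\<^sup>2)"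
  shows "summable (\<lambda>n. (f n + g n)\<^sup>2)"
proof (rule summable_comparison_test')
  show "summable (\<lambda>n. 2 * (f n)\<^sup>2 + 2 * (g n)\<^sup>2)"
    using assms by (intro summable_add summable_mult)
  show "norm ((f n + g n)\<^sup>2) \<le> 2 * (f n)\<^sup>2 + 2 * (g n)\<^sup>2" if "n \<ge> 0" for n
  proof -
    have "0 \<le> (f n - g n)\<^sup>2" by simp
    then have "(f n + g n)\<^sup>2 \<le> 2 * (f n)\<^sup>2 + 2 * (g n)\<^sup>2"
      by (simp add: power2_sum power2_diff)
    then show ?thesis by simp
  qed
qed

lemma summable_square_mult:
  fixes f g :: "nat \<Rightarrow> real"
  assumes "summable (\<lambda>n. (f n)\<^sup>2)" "summable (\<lambda>n. (g n)\<^sup>2)"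
  shows "summable (\<lambda>n. f n * g n)"
proof (rule summable_comparison_test')
  show "summable (\<lambda>n. (f n)\<^sup>2 + (g n)\<^sup>2)"
    using assms by (rule summable_add)
  show "norm (f n * g n) \<le> (f n)\<^sup>2 + (g n)\<^sup>2" if "n \<ge> 0" for n
  proof -
    have "2 * (\<bar>f n\<bar> * \<bar>g n\<bar>) \<le> (f n)\<^sup>2 + (g n)\<^sup>2" "0 \<le> \<bar>f n\<bar> * \<bar>g n\<bar>"
      using sum_squares_bound[of "\<bar>f n\<bar>" "\<bar>g n\<bar>"] by simp_all
    then show ?thesis unfolding real_norm_def abs_mult by linarith
  qed
qed

text \<open>
  The terms of type \<open>mat_term\<close> are countably many, so some positive sequence decreases fast enough to
  stay square summable after multiplication with every entry.
\<close>

typedef wseq = "{f :: nat \<Rightarrow> real. \<forall>X i j. summable (\<lambda>n. (entry X i j n * f n)\<^sup>2)}"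
  morphisms seq Wseq
  by (rule exI[of _ "\<lambda>_. 0"]) simp

setup_lifting type_definition_wseq

lemma summable_entry: "summable (\<lambda>n. (entry X i j n * seq f n)\<^sup>2)"
  using seq[of f] by simp

lemma summable_seq: "summable (\<lambda>n. (seq f n)\<^sup>2)"
  using summable_entry[of MOne 1 1 f] by (simp add: entry_def mat_def)

lemma summable_seq_mult: "summable (\<lambda>n. seq f n * seq g n)"
  by (intro summable_square_mult summable_seq)

instantiation wseq :: real_inner
begin

lift_definition zero_wseq :: wseq is "\<lambda>_. 0" by simp

lift_definition plus_wseq :: "wseq \<Rightarrow> wseq \<Rightarrow> wseq" is "\<lambda>f g n. f n + g n"
  by (simp add: distrib_left summable_square_add)

lift_definition scaleR_wseq :: "real \<Rightarrow> wseq \<Rightarrow> wseq" is "\<lambda>r f n. r * f n"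
  by (simp add: mult.left_commute power_mult_distrib summable_mult)

definition uminus_wseq :: "wseq \<Rightarrow> wseq" where "uminus_wseq f = (- 1) *\<^sub>R f"

definition minus_wseq :: "wseq \<Rightarrow> wseq \<Rightarrow> wseq" where "minus_wseq f g = f + - g"

definition inner_wseq :: "wseq \<Rightarrow> wseq \<Rightarrow> real" where
  "inner_wseq f g = (\<Sum>n. seq f n * seq g n)"

definition norm_wseq :: "wseq \<Rightarrow> real" where "norm_wseq f = sqrt (f \<bullet> f)"

definition dist_wseq :: "wseq \<Rightarrow> wseq \<Rightarrow> real" where "dist_wseq f g = norm (f - g)"

definition sgn_wseq :: "wseq \<Rightarrow> wseq" where "sgn_wseq f = inverse (norm f) *\<^sub>R f"

definition uniformity_wseq :: "(wseq \<times> wseq) filter" where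
  "uniformity_wseq = (INF e\<in>{0<..}. principal {(x, y). dist x y < e})"

definition open_wseq :: "wseq set \<Rightarrow> bool" where
  "open_wseq U \<longleftrightarrow> (\<forall>x\<in>U. eventually (\<lambda>(x', y). x' = x \<longrightarrow> y \<in> U) uniformity)"

instance
proof
  fix f g h :: wseq and r s :: real
  have sq: "seq (f + g) n = seq f n + seq g n" "seq (r *\<^sub>R f) n = r * seq f n" for f g r n
    by (simp_all add: plus_wseq.rep_eq scaleR_wseq.rep_eq)
  have eqI: "x = y" if "\<And>n. seq x n = seq y n" for x y
    using that by (simp add: fun_eq_iff flip: seq_inject)
  show "f + g + h = f + (g + h)" "f + g = g + f" "0 + f = f"
    by (rule eqI, simp add: sq zero_wseq.rep_eq)+
  show "- f + f = 0"
    by (rule eqI) (simp add: sq uminus_wseq_def zero_wseq.rep_eq)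
  show "f - g = f + - g" by (rule minus_wseq_def)
  show "r *\<^sub>R (f + g) = r *\<^sub>R f + r *\<^sub>R g" "(r + s) *\<^sub>R f = r *\<^sub>R f + s *\<^sub>R f"
    "r *\<^sub>R s *\<^sub>R f = (r * s) *\<^sub>R f" "1 *\<^sub>R f = f"
    by (rule eqI, simp add: sq distrib_left distrib_right)+
  show "dist f g = norm (f - g)" by (rule dist_wseq_def)
  show "sgn f = inverse (norm f) *\<^sub>R f" by (rule sgn_wseq_def)
  show "(uniformity :: (wseq \<times> wseq) filter) = (INF e\<in>{0<..}. principal {(x, y). dist x y < e})"
    by (rule uniformity_wseq_def)
  show "open U = (\<forall>x\<in>U. \<forall>\<^sub>F (x', y) in uniformity. x' = x \<longrightarrow> y \<in> U)" for U :: "wseq set"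
    by (rule open_wseq_def)
  show "f \<bullet> g = g \<bullet> f" by (simp add: inner_wseq_def mult.commute)
  show "(f + g) \<bullet> h = f \<bullet> h + g \<bullet> h"
    by (simp add: inner_wseq_def sq distrib_right suminf_add summable_seq_mult)
  show "r *\<^sub>R f \<bullet> g = r * (f \<bullet> g)"
    by (simp add: inner_wseq_def sq mult.assoc suminf_mult summable_seq_mult)
  show "0 \<le> f \<bullet> f"
    by (simp add: inner_wseq_def suminf_nonneg summable_seq_mult)
  show "(f \<bullet> f = 0) = (f = 0)"
  proof
    assume "f \<bullet> f = 0"
    then have "\<forall>n. seq f n * seq f n = 0"
      unfolding inner_wseq_def using suminf_eq_zero_iff[OF summable_seq_mult[of f f]] by simp
    then show "f = 0" by (intro eqI) (simp add: zero_wseq.rep_eq)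
  next
    assume "f = 0"
    then show "f \<bullet> f = 0" by (simp add: inner_wseq_def zero_wseq.rep_eq)
  qed
  show "norm f = sqrt (f \<bullet> f)" by (rule norm_wseq_def)
qed

end

lemma seq_simps [simp]:
  "seq 0 n = 0"
  "seq (f + g) n = seq f n + seq g n"
  "seq (r *\<^sub>R f) n = r * seq f n"
  by (simp_all add: zero_wseq.rep_eq plus_wseq.rep_eq scaleR_wseq.rep_eq)

lemma seq_minus [simp]: "seq (- f) n = - seq f n"
  unfolding uminus_wseq_def seq_simps by simp

lemma seq_diff [simp]: "seq (f - g) n = seq f n - seq g n"
  unfolding minus_wseq_def seq_simps seq_minus by simp

lemma wseq_eqI: "(\<And>n. seq f n = seq g n) \<Longrightarrow> f = g"
  by (simp add: seq_inject[symmetric] fun_eq_iff)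

definition mult_entry :: "mat_term \<Rightarrow> 3 \<Rightarrow> 3 \<Rightarrow> wseq \<Rightarrow> wseq" where
  "mult_entry X i j f = Wseq (\<lambda>n. entry X i j n * seq f n)"

lemma seq_mult_entry [simp]: "seq (mult_entry X i j f) n = entry X i j n * seq f n"
proof -
  have "summable (\<lambda>n. (entry Y k l n * (entry X i j n * seq f n))\<^sup>2)" for Y k l
  proof -
    obtain Z where "\<forall>n. entry Z k j n = entry Y k l n * entry X i j n"
      using entry_mult[of k j Y l X i] by blast
    then show ?thesis
      using summable_entry[of Z k j f] by (simp add: mult.assoc)
  qed
  then have "seq (mult_entry X i j f) = (\<lambda>n. entry X i j n * seq f n)"
    unfolding mult_entry_def by (intro Wseq_inverse) simp
  then show ?thesis by simp
qed

lemma finite_support_wseq: "finite {n. f n \<noteq> 0} \<Longrightarrow> seq (Wseq f) = f"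
proof (rule Wseq_inverse)
  assume fin: "finite {n. f n \<noteq> 0}"
  have "summable (\<lambda>n. (entry X i j n * f n)\<^sup>2)" for X i j
    by (rule summable_finite[OF fin]) simp
  then show "f \<in> {f. \<forall>X i j. summable (\<lambda>n. (entry X i j n * f n)\<^sup>2)}" by simp
qed

text \<open>A diagonal argument: \<open>c n\<close> dominates the first \<open>n + 1\<close> entry
  sequences at \<open>n\<close>, so dividing a geometric sequence by \<open>c\<close> beats each
  entry sequence from its own index on.\<close>

lemma exists_positive_wseq: "\<exists>b. \<forall>n. 0 < seq b n"
proof -
  define E where "E k = (case from_nat k of (X, i, j) \<Rightarrow> entry X i j)" for k
  have E: "E (to_nat (X, i, j)) = entry X i j" for X i j by (simp add: E_def)
  define c where "c n = 1 + (\<Sum>k\<le>n. \<bar>E k n\<bar>)" for n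
  define f where "f n = (1/2) ^ n / c n" for n
  have c: "c n \<ge> 1" for n by (simp add: c_def sum_nonneg)
  have "summable (\<lambda>n. (entry X i j n * f n)\<^sup>2)" for X i j
  proof (rule summable_comparison_test')
    define k where "k = to_nat (X, i, j)"
    show "summable (\<lambda>n. (1/4 :: real) ^ n)" by (simp add: summable_geometric)
    fix n assume "n \<ge> k"
    then have "\<bar>E k n\<bar> \<le> (\<Sum>k\<le>n. \<bar>E k n\<bar>)"
      by (intro member_le_sum) auto
    then have "\<bar>entry X i j n\<bar> \<le> c n" by (simp add: c_def k_def E)
    then have "\<bar>entry X i j n * f n\<bar> \<le> (1/2) ^ n"
      using c[of n] by (simp add: f_def abs_mult field_simps)
    then have "\<bar>entry X i j n * f n\<bar>\<^sup>2 \<le> ((1/2) ^ n)\<^sup>2"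
      by (intro power_mono) auto
    then show "norm ((entry X i j n * f n)\<^sup>2) \<le> (1/4) ^ n"
      by (simp add: power_mult[symmetric] mult.commute power_mult power2_eq_square)
        (simp add: power_mult_distrib[symmetric])
  qed
  then have "seq (Wseq f) = f" by (intro Wseq_inverse) simp
  moreover have "f n > 0" for n using c[of n] by (simp add: f_def)
  ultimately show ?thesis by metis
qed

section \<open>Matrix sequences acting on triples\<close>

definition act :: "mat_term \<Rightarrow> wseq \<times> wseq \<times> wseq \<Rightarrow> wseq \<times> wseq \<times> wseq" where
  "act X = (\<lambda>(x, y, z).
     (mult_entry X 1 1 x + mult_entry X 1 2 y + mult_entry X 1 3 z,
      mult_entry X 2 1 x + mult_entry X 2 2 y + mult_entry X 2 3 z,
      mult_entry X 3 1 x + mult_entry X 3 2 y + mult_entry X 3 3 z))"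

lemma act_cong: "(\<And>n. mat_seq X n = mat_seq Y n) \<Longrightarrow> act X = act Y"
  by (auto simp: act_def entry_def intro!: wseq_eqI)

lemma mult_entry_add_right: "mult_entry X i j (x + y) = mult_entry X i j x + mult_entry X i j y"
  by (rule wseq_eqI) (simp add: algebra_simps)

lemma mult_entry_mult:
  "mult_entry (MMult X Y) i j x = mult_entry X i 1 (mult_entry Y 1 j x) +
     mult_entry X i 2 (mult_entry Y 2 j x) + mult_entry X i 3 (mult_entry Y 3 j x)"
  by (rule wseq_eqI) (simp add: entry_def matrix_matrix_mult_def sum_3 algebra_simps)

lemma mult_entry_transpose: "mult_entry (MTranspose X) i j x = mult_entry X j i x"
  by (rule wseq_eqI) (simp add: entry_def transpose_def)

lemma act_mult: "act (MMult X Y) = act X \<circ> act Y"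
  by (rule ext) (simp add: act_def mult_entry_mult mult_entry_add_right algebra_simps split: prod.split)

lemma mult_entry_self_adjoint: "mult_entry X i j x \<bullet> y = x \<bullet> mult_entry X i j y"
  by (simp add: inner_wseq_def mult.assoc mult.left_commute)

lemma star_regular_act: "star_regular_operators (range act)"
proof (rule star_regular_operators.intro)
  show "id \<in> range act"
    by (rule range_eqI[of _ _ MOne])
      (auto simp: act_def entry_def mat_def intro!: ext wseq_eqI)
next
  fix T assume "T \<in> range act"
  then obtain X where T: "T = act X" by blast
  show "linear T"
    by (rule linearI) (auto simp: T act_def algebra_simps intro!: wseq_eqI)
  have "adjoint_pair T (act (MTranspose X))"
    by (simp add: adjoint_pair_def T act_def mult_entry_transpose inner_add_left inner_add_right
        mult_entry_self_adjoint)
  then show "\<exists>T'\<in>range act. adjoint_pair T T'" by blast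
  have "T (act (MQuasiInv X) (T x)) = T x" for x
  proof -
    have "act (MMult (MMult X (MQuasiInv X)) X) = act X"
      by (rule act_cong) (simp add: quasi_inverse)
    then show ?thesis by (simp add: T act_mult fun_eq_iff del: split_paired_All)
  qed
  then show "\<exists>G\<in>range act. \<forall>x. T (G (T x)) = T x" by blast
  fix U assume "U \<in> range act"
  then obtain Y where U: "U = act Y" by blast
  show "(\<lambda>x. T x + U x) \<in> range act"
    by (rule range_eqI[of _ _ "MAdd X Y"])
      (auto simp: act_def T U entry_def algebra_simps intro!: ext wseq_eqI)
  show "(\<lambda>x. T x - U x) \<in> range act"
    by (rule range_eqI[of _ _ "MDiff X Y"])
      (auto simp: act_def T U entry_def algebra_simps intro!: ext wseq_eqI)
  show "T \<circ> U \<in> range act"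
    unfolding T U act_mult[symmetric] by blast
qed

interpretation ambient: star_regular_operators "finite_rank_perturbations (range act)"
  by (rule star_regular_operators.star_regular_finite_rank_perturbations[OF star_regular_act])

section \<open>The generating operators\<close>

definition alpha :: "wseq \<Rightarrow> wseq" where
  "alpha = mult_entry MDiag 1 1"

lemma seq_alpha: "seq (alpha f) n = seq f n / (real n + 1)"
  by (simp add: alpha_def entry_def mat_def)

lemma alpha_self_adjoint: "alpha x \<bullet> y = x \<bullet> alpha y"
  unfolding alpha_def by (rule mult_entry_self_adjoint)

lemma alpha_linear: "linear alpha"
  by (rule linearI) (auto simp: seq_alpha add_divide_distrib intro!: wseq_eqI)

lemma alpha_inj: "alpha x = alpha y \<longleftrightarrow> x = y"
proof
  assume "alpha x = alpha y"
  then have "seq (alpha x) n = seq (alpha y) n" for n by simp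
  then have "seq x n = seq y n" for n
    using of_nat_0_le_iff[of n, where 'a = real] by (simp add: seq_alpha)
  then show "x = y" by (rule wseq_eqI)
qed simp

text \<open>Multiplication by \<open>n + 1\<close> also preserves the space, because it is an entry
  of a quasi-inverse of the diagonal term: a quasi-inverse is chosen arbitrarily, but for an
  invertible scalar matrix it can only be the inverse.\<close>

lemma alpha_surj: "\<exists>x. alpha x = y"
proof
  have "entry (MQuasiInv MDiag) 1 1 n = real n + 1" for n
  proof -
    define c where "c = 1 / (real n + 1)"
    have c: "c \<noteq> 0" by (simp add: c_def)
    have "((mat c :: real^3^3) ** quasi_inverse (mat c) ** mat c) $ 1 $ 1 = (mat c :: real^3^3) $ 1 $ 1"
      by (simp only: quasi_inverse)
    then have "c * quasi_inverse (mat c :: real^3^3) $ 1 $ 1 * c = c"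
      by (simp add: matrix_matrix_mult_def sum_3 mat_def)
    then have "quasi_inverse (mat c :: real^3^3) $ 1 $ 1 = 1 / c"
      using c by (simp add: field_simps)
    then show ?thesis by (simp add: entry_def flip: c_def) (simp add: c_def)
  qed
  then have "seq (alpha (mult_entry (MQuasiInv MDiag) 1 1 y)) n = seq y n" for n
    using of_nat_0_le_iff[of n, where 'a = real] by (simp add: seq_alpha)
  then show "alpha (mult_entry (MQuasiInv MDiag) 1 1 y) = y" by (rule wseq_eqI)
qed

definition bvec :: wseq where
  "bvec = (SOME b. \<forall>n. 0 < seq b n)"

lemma seq_bvec_pos: "0 < seq bvec n"
  unfolding bvec_def using someI_ex[OF exists_positive_wseq] by blast

lemma bvec_nonzero: "bvec \<noteq> 0"
  using seq_bvec_pos[of 0] by auto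

definition beta :: "wseq \<Rightarrow> wseq" where
  "beta x = x + (bvec \<bullet> x) *\<^sub>R bvec"

lemma beta_self_adjoint: "beta x \<bullet> y = x \<bullet> beta y"
  by (simp add: beta_def inner_add_left inner_add_right inner_commute)

lemma beta_linear: "linear beta"
  by (rule linearI) (simp_all add: beta_def inner_add_right algebra_simps)

lemma inner_bvec_beta: "bvec \<bullet> beta x = (1 + bvec \<bullet> bvec) * (bvec \<bullet> x)"
  by (simp add: beta_def inner_add_right algebra_simps)

lemma one_plus_bvec: "1 + bvec \<bullet> bvec > 0"
  using inner_ge_zero[of bvec] by linarith

lemma beta_inj: "beta x = beta y \<longleftrightarrow> x = y"
proof
  assume eq: "beta x = beta y"
  then have "(1 + bvec \<bullet> bvec) * (bvec \<bullet> x) = (1 + bvec \<bullet> bvec) * (bvec \<bullet> y)"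
    by (simp flip: inner_bvec_beta)
  then have "bvec \<bullet> x = bvec \<bullet> y" using one_plus_bvec by simp
  then show "x = y" using eq by (simp add: beta_def)
qed simp

lemma beta_surj: "\<exists>x. beta x = y"
proof
  let ?c = "1 + bvec \<bullet> bvec"
  have c: "?c \<noteq> 0" using one_plus_bvec by simp
  \<comment> \<open>The preimage is given by the Sherman-Morrison formula for the inverse of
    \<open>1 + b b\<^sup>*\<close>.\<close>
  have "bvec \<bullet> (y - (bvec \<bullet> y / ?c) *\<^sub>R bvec) = bvec \<bullet> y / ?c"
    using c by (simp add: inner_diff_right field_simps)
  then show "beta (y - (bvec \<bullet> y / ?c) *\<^sub>R bvec) = y"
    by (simp add: beta_def)
qed

lemma beta_bvec: "beta bvec = (1 + bvec \<bullet> bvec) *\<^sub>R bvec"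
  by (simp add: beta_def algebra_simps)

text \<open>Each application of \<open>beta\<close> multiplies the inner product with
  \<open>bvec\<close> by \<open>1 + bvec \<bullet> bvec\<close>, whose square exceeds 1.\<close>

lemma beta_beta_fixed: "beta (beta x) = x \<longleftrightarrow> bvec \<bullet> x = 0"
proof
  assume "beta (beta x) = x"
  then have "(1 + bvec \<bullet> bvec) * ((1 + bvec \<bullet> bvec) * (bvec \<bullet> x)) = bvec \<bullet> x"
    by (metis inner_bvec_beta)
  moreover have "(1 + bvec \<bullet> bvec) * (1 + bvec \<bullet> bvec) > 1"
    using bvec_nonzero by (simp add: less_1_mult)
  ultimately show "bvec \<bullet> x = 0"
    by (metis mult.assoc mult_cancel_right1 less_irrefl)
qed (simp add: beta_def)

section \<open>Axes and graphs as ranges of operators\<close>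

definition axis1 :: "(wseq \<times> wseq \<times> wseq) set" where "axis1 = {(x, 0, 0) | x. True}"
definition axis2 :: "(wseq \<times> wseq \<times> wseq) set" where "axis2 = {(0, x, 0) | x. True}"
definition axis3 :: "(wseq \<times> wseq \<times> wseq) set" where "axis3 = {(0, 0, x) | x. True}"
definition graph12 :: "(wseq \<times> wseq \<times> wseq) set" where "graph12 = {(x, - alpha x, 0) | x. True}"
definition graph13 :: "(wseq \<times> wseq \<times> wseq) set" where "graph13 = {(x, 0, - beta x) | x. True}"
text \<open>Forced by the frame identities: the elements are the differences of
  \<open>(x, 0, - beta x)\<close> and \<open>(x, - alpha x, 0)\<close>, in which the first
  coordinate cancels.\<close>

definition graph23 :: "(wseq \<times> wseq \<times> wseq) set" where
  "graph23 = {(0, alpha x, - beta x) | x. True}"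

lemmas frame_sets = axis1_def axis2_def axis3_def graph12_def graph13_def graph23_def

text \<open>Each frame subspace is parametrized by a single sequence, so it is the range of an
  operator on triples that reads only the first coordinate.\<close>

lemma ambient_rangesI:
  assumes "finite_rank n N" "\<And>x y z. act X (x, y, z) + N (x, y, z) = F x"
  shows "{F x | x. True} \<in> ambient.ranges"
proof -
  have "(\<lambda>v. act X v + N v) \<in> finite_rank_perturbations (range act)"
    by (rule finite_rank_perturbationsI[OF _ assms(1) refl]) simp
  moreover have "range (\<lambda>v. act X v + N v) = {F x | x. True}"
  proof
    show "range (\<lambda>v. act X v + N v) \<subseteq> {F x | x. True}"
      using assms(2) by force
    show "{F x | x. True} \<subseteq> range (\<lambda>v. act X v + N v)"
    proof
      fix v assume "v \<in> {F x | x. True}"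
      then obtain x where "v = F x" by blast
      then show "v \<in> range (\<lambda>v. act X v + N v)"
        by (intro image_eqI[of _ _ "(x, 0, 0)"]) (simp_all only: assms(2) UNIV_I)
    qed
  qed
  ultimately show ?thesis
    unfolding ambient.ranges_def by (intro image_eqI[of _ _ "\<lambda>v. act X v + N v"]) simp_all
qed

lemma mult_entry_unit:
  "mult_entry (MUnit k l) i j x = (if i = k \<and> j = l then x else 0)"
  by (rule wseq_eqI) (simp add: entry_def)

lemma mult_entry_diag_unit:
  "mult_entry (MMult MDiag (MUnit k l)) i j x = (if i = k \<and> j = l then alpha x else 0)"
  by (rule wseq_eqI)
    (auto simp: entry_def seq_alpha matrix_matrix_mult_def mat_def if_distrib[of "\<lambda>x. x * _"] cong: if_cong)

lemma mult_entry_diff: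
  "mult_entry (MDiff X Y) i j x = mult_entry X i j x - mult_entry Y i j x"
  by (rule wseq_eqI) (simp add: entry_def algebra_simps)

lemma frame_ambient:
  "axis1 \<in> ambient.ranges" "axis2 \<in> ambient.ranges" "axis3 \<in> ambient.ranges"
  "graph12 \<in> ambient.ranges" "graph13 \<in> ambient.ranges" "graph23 \<in> ambient.ranges"
proof -
  note entries = act_def mult_entry_unit mult_entry_diag_unit mult_entry_diff
  show "axis1 \<in> ambient.ranges"
    unfolding axis1_def by (rule ambient_rangesI[OF finite_rank.zero, of "MUnit 1 1"]) (simp add: entries)
  show "graph12 \<in> ambient.ranges"
    unfolding graph12_def
    by (rule ambient_rangesI[OF finite_rank.zero, of "MDiff (MUnit 1 1) (MMult MDiag (MUnit 2 1))"])
      (simp add: entries)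
  show "axis2 \<in> ambient.ranges"
    unfolding axis2_def by (rule ambient_rangesI[OF finite_rank.zero, of "MUnit 2 1"]) (simp add: entries)
  show "axis3 \<in> ambient.ranges"
    unfolding axis3_def by (rule ambient_rangesI[OF finite_rank.zero, of "MUnit 3 1"]) (simp add: entries)
  show "graph13 \<in> ambient.ranges"
    unfolding graph13_def
    \<comment> \<open>The matrix term supplies the identity part of \<open>- beta\<close>, and the
      rank-one operator its part \<open>- b b\<^sup>*\<close>.\<close>
    by (rule ambient_rangesI[OF finite_rank_rank_one[of "(bvec, 0, 0)" "(0, 0, - bvec)"],
          of "MDiff (MUnit 1 1) (MUnit 3 1)"])
      (simp add: entries beta_def)
  show "graph23 \<in> ambient.ranges"
    unfolding graph23_def
    by (rule ambient_rangesI[OF finite_rank_rank_one[of "(bvec, 0, 0)" "(0, 0, - bvec)"],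
          of "MDiff (MMult MDiag (MUnit 2 1)) (MUnit 3 1)"])
      (simp add: entries beta_def)
qed

lemma funpow_alpha_self_adjoint: "(alpha ^^ k) x \<bullet> y = x \<bullet> (alpha ^^ k) y"
  by (induction k arbitrary: x y) (simp_all add: alpha_self_adjoint funpow_swap1)

lemma seq_funpow_alpha: "seq ((alpha ^^ k) f) n = seq f n / (real n + 1) ^ k"
  by (induction k) (simp_all add: seq_alpha mult.commute)

lemma funpow_alpha_bvec_nonzero: "(alpha ^^ k) bvec \<noteq> 0"
proof
  assume "(alpha ^^ k) bvec = 0"
  then have "seq ((alpha ^^ k) bvec) 0 = 0" by simp
  then show False using seq_bvec_pos[of 0] by (simp add: seq_funpow_alpha)
qed

lemma inner_funpow_alpha_bvec_pos: "(alpha ^^ (2 * k)) bvec \<bullet> bvec > 0"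
proof -
  have "(alpha ^^ (2 * k)) bvec \<bullet> bvec = (alpha ^^ k) bvec \<bullet> (alpha ^^ k) bvec"
    by (simp add: mult_2 funpow_add funpow_alpha_self_adjoint)
  then show ?thesis using funpow_alpha_bvec_nonzero by simp
qed

text \<open>
  After scaling by \<open>(m + 1) ^ (2 * k)\<close>, the terms \<open>n > m\<close> of the inner product vanish in the limit
  \<open>k \<longlonglongrightarrow> \<infinity>\<close>, so the first nonzero entry of \<open>z\<close> is detected.
\<close>

lemma funpow_alpha_bvec_dense:
  assumes z: "\<And>k. (alpha ^^ (2 * k)) bvec \<bullet> z = 0"
  shows "z = 0"
proof (rule wseq_eqI)
  fix m
  show "seq z m = seq 0 m"
  proof (induction m rule: less_induct)
    case (less m)
    define c where "c n = seq bvec n * seq z n" for n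
    \<comment> \<open>The square of the largest ratio \<open>(m + 1) / (n + 1)\<close> over
      \<open>n > m\<close>, attained at \<open>n = m + 1\<close>; the square matches the even powers
      of \<open>alpha\<close>.\<close>
    define q where "q = ((real m + 1) / (real m + 2))\<^sup>2"
    have q: "0 \<le> q" "q < 1"
      by (simp_all add: q_def power_less_one_iff)
    have "summable (\<lambda>n. \<bar>seq bvec n\<bar> * \<bar>seq z n\<bar>)"
      by (rule summable_square_mult) (simp_all add: summable_seq)
    then have abs_c: "summable (\<lambda>n. \<bar>c n\<bar>)" by (simp add: c_def abs_mult)
    have bound: "\<bar>c m\<bar> \<le> (\<Sum>n. \<bar>c n\<bar>) * q ^ k" for k
    proof -
      \<comment> \<open>The terms of the vanishing inner product, scaled so that the term at
        \<open>m\<close> does not depend on \<open>k\<close>. Dropping that term leaves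
        \<open>g\<close>, which therefore sums to \<open>- c m\<close>.\<close>
      define f where "f n = c n * ((real m + 1) / (real n + 1)) ^ (2 * k)" for n
      define g where "g n = (if n = m then 0 else f n)" for n
      have f_eq: "f n = (real m + 1) ^ (2 * k) * (seq ((alpha ^^ (2 * k)) bvec) n * seq z n)" for n
        by (simp add: f_def c_def seq_funpow_alpha power_divide)
      have "f sums ((real m + 1) ^ (2 * k) * ((alpha ^^ (2 * k)) bvec \<bullet> z))"
        unfolding f_eq inner_wseq_def by (intro sums_mult summable_sums summable_seq_mult)
      then have "f sums 0" using z by simp
      moreover have "(\<lambda>n. if n = m then f n else 0) sums f m" by (rule sums_single)
      ultimately have "(\<lambda>n. f n - (if n = m then f n else 0)) sums (0 - f m)" by (rule sums_diff)
      moreover have "f n - (if n = m then f n else 0) = g n" for n by (simp add: g_def)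
      moreover have "f m = c m" by (simp add: f_def)
      ultimately have g: "g sums (- c m)" by simp
      have le: "\<bar>g n\<bar> \<le> \<bar>c n\<bar> * q ^ k" for n
      proof (cases "n \<le> m")
        case True
        then have "g n = 0" using less.IH[of n] by (auto simp: g_def f_def c_def)
        then show ?thesis using q by simp
      next
        case False
        then have "(real m + 1) / (real n + 1) \<le> (real m + 1) / (real m + 2)"
          by (intro divide_left_mono) auto
        then have "((real m + 1) / (real n + 1)) ^ (2 * k) \<le> ((real m + 1) / (real m + 2)) ^ (2 * k)"
          by (intro power_mono) auto
        also have "\<dots> = q ^ k" by (simp add: q_def power_mult)
        finally show ?thesis
          using False by (simp add: g_def f_def abs_mult mult_left_mono)
      qed
      have sc: "summable (\<lambda>n. \<bar>c n\<bar> * q ^ k)" using abs_c by (rule summable_mult2)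
      have sg: "summable (\<lambda>n. \<bar>g n\<bar>)"
        by (rule summable_comparison_test'[OF sc, of 0]) (use le in simp)
      have "\<bar>c m\<bar> = \<bar>suminf g\<bar>" using sums_unique[OF g] by simp
      also have "\<dots> \<le> (\<Sum>n. \<bar>g n\<bar>)" using sg by (rule summable_rabs)
      also have "\<dots> \<le> (\<Sum>n. \<bar>c n\<bar> * q ^ k)" using le sg sc by (rule suminf_le)
      also have "\<dots> = (\<Sum>n. \<bar>c n\<bar>) * q ^ k" using suminf_mult2[OF abs_c] by simp
      finally show ?thesis .
    qed
    have "(\<lambda>k. (\<Sum>n. \<bar>c n\<bar>) * q ^ k) \<longlonglongrightarrow> (\<Sum>n. \<bar>c n\<bar>) * 0"
      using q by (intro tendsto_mult tendsto_const LIMSEQ_power_zero) simp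
    then have "\<bar>c m\<bar> \<le> 0"
      using bound by (intro LIMSEQ_le_const) auto
    then show ?case using seq_bvec_pos[of m] by (simp add: c_def)
  qed
qed

text \<open>The unit sequences have finite support, hence lie in the space, and placed in the first
  coordinate they form an infinite orthonormal family.\<close>

lemma infinite_dimensional_wseq:
  assumes "finite B"
  shows "span B \<noteq> (UNIV :: (wseq \<times> wseq \<times> wseq) set)"
proof
  assume span: "span B = (UNIV :: (wseq \<times> wseq \<times> wseq) set)"
  define u where "u k = Wseq (\<lambda>n. if n = k then 1 else 0)" for k :: nat
  have u: "seq (u k) = (\<lambda>n. if n = k then 1 else 0)" for k
    unfolding u_def by (rule finite_support_wseq) simp
  define v where "v k = (u k, 0 :: wseq, 0 :: wseq)" for k
  have inner_u: "u k \<bullet> u l = (if k = l then 1 else 0)" for k l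
  proof -
    have "(\<lambda>n. seq (u k) n * seq (u l) n) = (\<lambda>n. if n = k then (if k = l then 1 else 0) else 0)"
      by (auto simp: u)
    then show ?thesis
      using sums_unique[OF sums_single[of k "\<lambda>_. if k = l then 1 else 0 :: real"]]
      by (simp add: inner_wseq_def)
  qed
  have "inj v"
  proof (rule injI)
    fix k l assume "v k = v l"
    then have "seq (u k) k = seq (u l) k" by (simp add: v_def)
    then show "k = l" by (simp add: u split: if_splits)
  qed
  have "independent (range v)"
  proof (rule pairwise_orthogonal_independent)
    show "pairwise orthogonal (range v)"
      by (auto simp: pairwise_def orthogonal_def v_def inner_u)
    show "0 \<notin> range v"
    proof
      assume "0 \<in> range v"
      then obtain k where "u k = 0" by (auto simp: v_def zero_prod_def)
      then show False using inner_u[of k k] by simp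
    qed
  qed
  then have "finite (range v)"
    using independent_span_bound[OF assms, of "range v"] span by auto
  then show False
    using \<open>inj v\<close> finite_imageD infinite_UNIV_nat by blast
qed

section \<open>The lattice generated by the frame\<close>

text \<open>Terms for the generated ortholattice; meets and the top element are expressible by
  complements. Countability of the terms is what provides codes in the natural numbers.\<close>

datatype space_term =
    SGen nat nat
  | SZero
  | SComp space_term
  | SPlus space_term space_term

instance space_term :: countable
  by countable_datatype

primrec space_of :: "(nat \<Rightarrow> nat \<Rightarrow> 'a::real_inner set) \<Rightarrow> space_term \<Rightarrow> 'a set" where
  "space_of g (SGen i j) = g i j"
| "space_of g SZero = {0}"
| "space_of g (SComp t) = (space_of g t)\<^sup>\<bottom>"
| "space_of g (SPlus s t) = space_of g s + space_of g t"

lemma (in star_regular_operators) space_of_ranges: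
  assumes "\<And>i j. g i j \<in> ranges"
  shows "space_of g t \<in> ranges"
  by (induction t) (simp_all add: assms ranges_zero ranges_comp_split ranges_plus)

lemma (in star_regular_operators) split_subspaces_space_of:
  assumes "\<And>i j. g i j \<in> ranges"
  shows "split_subspaces (range (space_of g)) (to_nat_on (range (space_of g)))"
proof
  show "inj_on (to_nat_on (range (space_of g))) (range (space_of g))"
    by (intro inj_on_to_nat_on countable_image countableI_type)
next
  fix X assume "X \<in> range (space_of g)"
  then obtain t where X: "X = space_of g t" by blast
  show "subspace X" "X + X\<^sup>\<bottom> = UNIV"
    using space_of_ranges[OF assms, where t = t] by (simp_all add: X ranges_subspace ranges_comp_split)
  show "X\<^sup>\<bottom> \<in> range (space_of g)"
    by (rule range_eqI[of _ _ "SComp t"]) (simp add: X)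
  fix Y assume "Y \<in> range (space_of g)"
  then obtain s where Y: "Y = space_of g s" by blast
  show "X + Y \<in> range (space_of g)"
    by (rule range_eqI[of _ _ "SPlus t s"]) (simp add: X Y)
next
  show "{0} \<in> range (space_of g)"
    by (rule range_eqI[of _ _ SZero]) simp
qed

lemma ol_generated_space_of:
  assumes "split_subspaces (range (space_of g)) e"
    and gens: "\<And>i j. g i j = {0} \<or> e (g i j) \<in> X"
    and X: "X \<subseteq> e ` range (space_of g)"
  shows "ol_generated_by (split_subspaces.coded_lattice (range (space_of g)) e) X"
proof -
  interpret split_subspaces "range (space_of g)" e by fact
  have "ol_subalgebra K (carrier K)"
    unfolding ol_subalgebra_def
    by (simp add: modular_ortholattice.ortho_closed[OF modular_ortholattice_K])
  then have "ol_subalgebra K hull X \<subseteq> carrier K"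
    using X by (intro hull_minimal) (simp_all add: carrier_K)
  moreover have "e (space_of g t) \<in> ol_subalgebra K hull X" for t
    unfolding hull_def
  proof (rule InterI)
    fix T assume "T \<in> {T. ol_subalgebra K T \<and> X \<subseteq> T}"
    then have T: "ol_subalgebra K T" "X \<subseteq> T" by auto
    show "e (space_of g t) \<in> T"
    proof (induction t)
      case (SGen i j)
      then show ?case using gens[of i j] T by (auto simp: ol_subalgebra_def bottom_K)
    next
      case SZero
      then show ?case using T by (auto simp: ol_subalgebra_def bottom_K)
    next
      case (SComp t)
      then have "ortho K (e (space_of g t)) \<in> T"
        using T by (simp add: ol_subalgebra_def)
      then show ?case by (simp add: ortho_K)
    next
      case (SPlus s t)
      then have "e (space_of g s) \<squnion>\<^bsub>K\<^esub> e (space_of g t) \<in> T"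
        using T by (simp add: ol_subalgebra_def)
      then show ?case by (simp add: join_K)
    qed
  qed
  ultimately show ?thesis
    using X unfolding ol_generated_by_def by (auto simp: carrier_K)
qed

text \<open>Equal indices stand for the axes. Index pairs outside the frame default to
  \<open>{0}\<close>, which lies in every subalgebra and so adds nothing to the generated
  lattice.\<close>

definition frame_space :: "nat \<Rightarrow> nat \<Rightarrow> (wseq \<times> wseq \<times> wseq) set" where
  "frame_space i j =
     (if i = 1 \<and> j = 1 then axis1 else if i = 2 \<and> j = 2 then axis2
      else if i = 3 \<and> j = 3 then axis3 else if {i, j} = {1, 2} then graph12
      else if {i, j} = {1, 3} then graph13 else if {i, j} = {2, 3} then graph23 else {0})"

lemma frame_space_simps:
  "frame_space 1 1 = axis1" "frame_space 2 2 = axis2" "frame_space 3 3 = axis3"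
  "frame_space 1 2 = graph12" "frame_space 2 1 = graph12"
  "frame_space 1 3 = graph13" "frame_space 3 1 = graph13"
  "frame_space 2 3 = graph23" "frame_space 3 2 = graph23"
  by (simp_all add: frame_space_def doubleton_eq_iff)

lemma frame_space_ambient: "frame_space i j \<in> ambient.ranges"
  by (simp add: frame_space_def frame_ambient ambient.ranges_zero)

definition frame_lattice :: "(wseq \<times> wseq \<times> wseq) set set" where
  "frame_lattice = range (space_of frame_space)"

definition code :: "(wseq \<times> wseq \<times> wseq) set \<Rightarrow> nat" where
  "code = to_nat_on frame_lattice"

interpretation frame: split_subspaces frame_lattice code
  unfolding frame_lattice_def code_def
  by (rule ambient.split_subspaces_space_of[OF frame_space_ambient])

lemma frame_space_mem: "frame_space i j \<in> frame_lattice"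
  unfolding frame_lattice_def by (rule range_eqI[of _ _ "SGen i j"]) simp

lemma frame_mem:
  "axis1 \<in> frame_lattice" "axis2 \<in> frame_lattice" "axis3 \<in> frame_lattice"
  "graph12 \<in> frame_lattice" "graph13 \<in> frame_lattice" "graph23 \<in> frame_lattice"
  using frame_space_mem[of 1 1] frame_space_mem[of 2 2] frame_space_mem[of 3 3]
    frame_space_mem[of 1 2] frame_space_mem[of 1 3] frame_space_mem[of 2 3]
  by (simp_all only: frame_space_simps)

lemma alpha_0 [simp]: "alpha 0 = 0" and alpha_minus [simp]: "alpha (- x) = - alpha x"
  and alpha_scaleR: "alpha (r *\<^sub>R x) = r *\<^sub>R alpha x"
  and alpha_eq_0 [simp]: "alpha x = 0 \<longleftrightarrow> x = 0"
  using alpha_linear alpha_inj[of x 0]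
  by (simp_all add: linear_0 linear_neg linear_scale)

lemma beta_0 [simp]: "beta 0 = 0" and beta_minus [simp]: "beta (- x) = - beta x"
  and beta_scaleR: "beta (r *\<^sub>R x) = r *\<^sub>R beta x"
  and beta_eq_0 [simp]: "beta x = 0 \<longleftrightarrow> x = 0"
  using beta_linear beta_inj[of x 0]
  by (simp_all add: linear_0 linear_neg linear_scale)

section \<open>The frame relations in coordinates\<close>

lemma triple_plus_iff:
  "(x, y, z) \<in> X + Y \<longleftrightarrow> (\<exists>a b c. (a, b, c) \<in> X \<and> (x - a, y - b, z - c) \<in> Y)"
  for X Y :: "('a::ab_group_add \<times> 'a \<times> 'a) set"
proof
  assume "(x, y, z) \<in> X + Y"
  then show "\<exists>a b c. (a, b, c) \<in> X \<and> (x - a, y - b, z - c) \<in> Y"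
  proof (rule set_plus_elim)
    fix u v assume uv: "(x, y, z) = u + v" "u \<in> X" "v \<in> Y"
    obtain a b c where u: "u = (a, b, c)" by (cases u)
    have "v = (x - a, y - b, z - c)" using uv(1) by (cases v) (simp add: u)
    then show ?thesis using uv u by blast
  qed
next
  assume "\<exists>a b c. (a, b, c) \<in> X \<and> (x - a, y - b, z - c) \<in> Y"
  then obtain a b c where "(a, b, c) \<in> X" "(x - a, y - b, z - c) \<in> Y" by blast
  from set_plus_intro[OF this] show "(x, y, z) \<in> X + Y" by simp
qed

lemma triple_orthogonal_comp_iff:
  "(x, y, z) \<in> X\<^sup>\<bottom> \<longleftrightarrow> (\<forall>a b c. (a, b, c) \<in> X \<longrightarrow> a \<bullet> x + (b \<bullet> y + c \<bullet> z) = 0)"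
  for X :: "('a::real_inner \<times> 'a \<times> 'a) set"
  by (auto simp: orthogonal_comp_iff)

lemma triple_set_eqI: "(\<And>x y z. (x, y, z) \<in> X \<longleftrightarrow> (x, y, z) \<in> Y) \<Longrightarrow> X = Y"
  by auto

lemma mem_frame_iff:
  "(x, y, z) \<in> axis1 \<longleftrightarrow> y = 0 \<and> z = 0"
  "(x, y, z) \<in> axis2 \<longleftrightarrow> x = 0 \<and> z = 0"
  "(x, y, z) \<in> axis3 \<longleftrightarrow> x = 0 \<and> y = 0"
  "(x, y, z) \<in> graph12 \<longleftrightarrow> y = - alpha x \<and> z = 0"
  "(x, y, z) \<in> graph13 \<longleftrightarrow> y = 0 \<and> z = - beta x"
  "(x, y, z) \<in> graph23 \<longleftrightarrow> x = 0 \<and> (\<exists>t. y = alpha t \<and> z = - beta t)"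
  by (auto simp: frame_sets)

lemma mem_graph23_iff: "(x, y, z) \<in> graph23 \<longleftrightarrow> x = 0 \<and> (\<exists>t. y = - alpha t \<and> z = beta t)"
  unfolding mem_frame_iff by (metis alpha_minus beta_minus minus_minus)

text \<open>Adding an axis forgets the corresponding coordinate, so sums with axes become
  existential quantifiers.\<close>

lemma mem_axis_plus_iff:
  "(x, y, z) \<in> axis1 + X \<longleftrightarrow> (\<exists>a. (a, y, z) \<in> X)"
  "(x, y, z) \<in> axis2 + X \<longleftrightarrow> (\<exists>a. (x, a, z) \<in> X)"
  "(x, y, z) \<in> axis3 + X \<longleftrightarrow> (\<exists>a. (x, y, a) \<in> X)"
proof -
  have ex: "(\<exists>a. P (u - a)) \<longleftrightarrow> (\<exists>a. P a)" for P and u :: wseq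
    by (metis diff_diff_eq2 add_diff_cancel_left')
  show "(x, y, z) \<in> axis1 + X \<longleftrightarrow> (\<exists>a. (a, y, z) \<in> X)"
    "(x, y, z) \<in> axis2 + X \<longleftrightarrow> (\<exists>a. (x, a, z) \<in> X)"
    "(x, y, z) \<in> axis3 + X \<longleftrightarrow> (\<exists>a. (x, y, a) \<in> X)"
    using ex[of "\<lambda>a. (a, y, z) \<in> X" x] ex[of "\<lambda>a. (x, a, z) \<in> X" y] ex[of "\<lambda>a. (x, y, a) \<in> X" z]
    by (simp_all add: triple_plus_iff mem_frame_iff)
qed

lemma minus_alpha_surj: "\<exists>a. y = - alpha a" "\<exists>a. - alpha a = y"
  and minus_beta_surj: "\<exists>a. y = - beta a" "\<exists>a. - beta a = y"
  using alpha_surj[of "- y"] beta_surj[of "- y"] by (metis minus_minus)+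

lemma frame_joins:
  "axis1 + graph12 = axis1 + axis2" "axis2 + graph12 = axis2 + axis1"
  "axis1 + graph13 = axis1 + axis3" "axis3 + graph13 = axis3 + axis1"
  "axis2 + graph23 = axis2 + axis3" "axis3 + graph23 = axis3 + axis2"
  by (rule triple_set_eqI; use alpha_surj beta_surj minus_alpha_surj minus_beta_surj in
      \<open>auto simp: mem_axis_plus_iff mem_frame_iff; metis\<close>)+

lemma frame_meets:
  "axis1 \<inter> (axis2 + axis3) = {0}" "axis2 \<inter> (axis1 + axis3) = {0}" "axis3 \<inter> (axis1 + axis2) = {0}"
  "axis1 \<inter> axis2 \<inter> axis3 = {0}"
  "axis1 \<inter> graph12 = {0}" "axis2 \<inter> graph12 = {0}"
  "axis1 \<inter> graph13 = {0}" "axis3 \<inter> graph13 = {0}"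
  "axis2 \<inter> graph23 = {0}" "axis3 \<inter> graph23 = {0}"
  by (rule triple_set_eqI; auto simp: mem_axis_plus_iff mem_frame_iff zero_prod_def)+

lemma frame_compositions:
  "(axis2 + axis3) \<inter> (graph12 + graph13) = graph23"
  "(axis1 + axis3) \<inter> (graph12 + graph23) = graph13"
  "(axis1 + axis2) \<inter> (graph13 + graph23) = graph12"
proof -
  show "(axis2 + axis3) \<inter> (graph12 + graph13) = graph23"
    by (rule triple_set_eqI)
      (auto simp: mem_axis_plus_iff mem_frame_iff(1-5) mem_graph23_iff triple_plus_iff)
  show "(axis1 + axis3) \<inter> (graph12 + graph23) = graph13"
    by (rule triple_set_eqI)
      (auto simp: mem_axis_plus_iff mem_frame_iff triple_plus_iff alpha_inj)
  show "(axis1 + axis2) \<inter> (graph13 + graph23) = graph12"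
    by (rule triple_set_eqI)
      (auto simp: mem_axis_plus_iff mem_frame_iff(1-5) mem_graph23_iff triple_plus_iff beta_inj)
qed

lemma axis_orthogonal:
  "axis1 \<subseteq> axis2\<^sup>\<bottom>" "axis1 \<subseteq> axis3\<^sup>\<bottom>" "axis2 \<subseteq> axis1\<^sup>\<bottom>"
  "axis2 \<subseteq> axis3\<^sup>\<bottom>" "axis3 \<subseteq> axis1\<^sup>\<bottom>" "axis3 \<subseteq> axis2\<^sup>\<bottom>"
  by (auto simp: triple_orthogonal_comp_iff mem_frame_iff)

abbreviation "atom_at i \<equiv> code (frame_space i i)"
abbreviation "link_at i j \<equiv> code (frame_space i j)"

lemma orthogonal_frame: "orthogonal_frame3 frame.coded_lattice atom_at link_at"
proof -
  note mem = frame_space_mem frame.plus frame.Int_mem frame.comp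
  have "axis3 \<inter> (axis1 \<inter> axis2) = {0}" using frame_meets(4) by blast
  then have "frame3 frame.coded_lattice atom_at link_at"
    unfolding frame3_def
  proof (intro conjI)
    show "frame_elements atom_at link_at \<subseteq> carrier frame.coded_lattice"
      by (auto simp: frame_elements_def frame.carrier_K frame_space_mem)
  qed (simp add: frame.join_K frame.meet_K mem frame.encode_eq frame_space_simps frame_mem
        frame_meets frame_joins frame_compositions add.commute Int_commute del: One_nat_def)
  then show ?thesis
    unfolding orthogonal_frame3_def
    by (simp add: frame.ortho_K frame.le_K mem frame_space_simps frame_mem axis_orthogonal del: One_nat_def)
qed

lemma generated_by_frame: "ol_generated_by frame.coded_lattice (frame_elements atom_at link_at)"
proof -
  have gens: "frame_space i j = {0} \<or> code (frame_space i j) \<in> frame_elements atom_at link_at" for i j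
  proof (cases "i \<in> {1, 2, 3} \<and> j \<in> {1, 2, 3}")
    case True
    then show ?thesis
      unfolding frame_elements_def by (cases "i = j") blast+
  next
    case False
    then have "frame_space i j = {0}" by (auto simp: frame_space_def doubleton_eq_iff)
    then show ?thesis ..
  qed
  have "frame_elements atom_at link_at \<subseteq> code ` range (space_of frame_space)"
    using frame_space_mem by (auto simp: frame_elements_def frame_lattice_def)
  then show ?thesis
    unfolding frame_lattice_def
    by (intro ol_generated_space_of frame.split_subspaces_axioms[unfolded frame_lattice_def] gens)
qed

lemma eq_if_inner_eq: "(\<And>z. x \<bullet> z = y \<bullet> z) \<Longrightarrow> x = y" for x y :: "'a::real_inner"
proof -
  assume "\<And>z. x \<bullet> z = y \<bullet> z"
  then have "(x - y) \<bullet> (x - y) = 0" by (simp add: inner_diff_left)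
  then show ?thesis by simp
qed

section \<open>Lines in the lattice\<close>

definition cograph12 :: "(wseq \<times> wseq \<times> wseq) set" where "cograph12 = {(alpha y, y, 0) | y. True}"
definition cograph13 :: "(wseq \<times> wseq \<times> wseq) set" where "cograph13 = {(beta z, 0, z) | z. True}"

lemma mem_cograph_iff:
  "(x, y, z) \<in> cograph12 \<longleftrightarrow> x = alpha y \<and> z = 0"
  "(x, y, z) \<in> cograph13 \<longleftrightarrow> x = beta z \<and> y = 0"
  by (auto simp: cograph12_def cograph13_def)

text \<open>Within a coordinate plane, the complement of the graph of \<open>- T\<close> is the
  graph of the adjoint of \<open>T\<close> in the reverse direction. As \<open>alpha\<close> and
  \<open>beta\<close> are self-adjoint, the lattice thus contains them as maps into the first axis
  too.\<close>

lemma cograph_mem: "cograph12 \<in> frame_lattice" "cograph13 \<in> frame_lattice"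
proof -
  have eq12: "cograph12 = graph12\<^sup>\<bottom> \<inter> (axis1 + axis2)"
  proof (rule triple_set_eqI)
    fix x y z
    have "(\<forall>a. a \<bullet> x = alpha a \<bullet> y) \<longleftrightarrow> x = alpha y"
      by (metis alpha_self_adjoint eq_if_inner_eq inner_commute)
    then show "(x, y, z) \<in> cograph12 \<longleftrightarrow> (x, y, z) \<in> graph12\<^sup>\<bottom> \<inter> (axis1 + axis2)"
      by (auto simp: mem_cograph_iff triple_orthogonal_comp_iff mem_axis_plus_iff mem_frame_iff)
  qed
  show "cograph12 \<in> frame_lattice"
    unfolding eq12 by (intro frame.comp frame.Int_mem frame.plus frame_mem)
  have eq13: "cograph13 = graph13\<^sup>\<bottom> \<inter> (axis1 + axis3)"
  proof (rule triple_set_eqI)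
    fix x y z
    have "(\<forall>a. a \<bullet> x = beta a \<bullet> z) \<longleftrightarrow> x = beta z"
      by (metis beta_self_adjoint eq_if_inner_eq inner_commute)
    then show "(x, y, z) \<in> cograph13 \<longleftrightarrow> (x, y, z) \<in> graph13\<^sup>\<bottom> \<inter> (axis1 + axis3)"
      by (auto simp: mem_cograph_iff triple_orthogonal_comp_iff mem_axis_plus_iff mem_frame_iff)
  qed
  show "cograph13 \<in> frame_lattice"
    unfolding eq13 by (intro frame.comp frame.Int_mem frame.plus frame_mem)
qed

text \<open>
  The graphs of \<open>beta * alpha\<^sup>-\<^sup>1\<close> and \<open>beta\<^sup>-\<^sup>1 * alpha\<^sup>-\<^sup>1\<close> between the second and the third axis
  agree exactly where \<open>beta\<^sup>2\<close> is the identity, that is, over the orthogonal complement of \<open>bvec\<close>.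
\<close>

lemma bvec_hyperplane_mem: "{(0, 0, z) | z. bvec \<bullet> z = 0} \<in> frame_lattice"
proof -
  define N0 where "N0 = (cograph12 + cograph13) \<inter> (axis2 + axis3)"
  have N0: "(x, y, z) \<in> N0 \<longleftrightarrow> x = 0 \<and> alpha y + beta z = 0" for x y z
    by (auto simp: N0_def triple_plus_iff mem_cograph_iff mem_axis_plus_iff mem_frame_iff
        neg_eq_iff_add_eq_0)
  define N1 where "N1 = N0\<^sup>\<bottom> \<inter> (axis2 + axis3)"
  have N1: "(x, y, z) \<in> N1 \<longleftrightarrow> x = 0 \<and> (\<exists>t. y = alpha t \<and> z = beta t)" for x y z
  proof
    assume N: "(x, y, z) \<in> N1"
    obtain t where t: "alpha t = y" using alpha_surj by blast
    have "z \<bullet> w = beta t \<bullet> w" for w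
    proof -
      obtain v where v: "alpha v = - beta w" using alpha_surj by blast
      then have "(0, v, w) \<in> N0" by (simp add: N0)
      then have "0 \<bullet> x + (v \<bullet> y + w \<bullet> z) = 0"
        using N unfolding N1_def triple_orthogonal_comp_iff Int_iff by blast
      moreover have "v \<bullet> y = - (w \<bullet> beta t)"
        by (metis alpha_self_adjoint beta_self_adjoint inner_minus_left t v)
      ultimately show ?thesis by (simp add: inner_commute)
    qed
    then have "z = beta t" by (rule eq_if_inner_eq)
    then show "x = 0 \<and> (\<exists>t. y = alpha t \<and> z = beta t)"
      using N t by (auto simp: N1_def mem_axis_plus_iff mem_frame_iff)
  next
    assume "x = 0 \<and> (\<exists>t. y = alpha t \<and> z = beta t)"
    then obtain t where t: "x = 0" "y = alpha t" "z = beta t" by blast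
    have "v \<bullet> alpha t + w \<bullet> beta t = 0" if "alpha v + beta w = 0" for v w
      using that by (simp flip: alpha_self_adjoint beta_self_adjoint inner_add_left)
    then show "(x, y, z) \<in> N1"
      by (auto simp: t N1_def N0 triple_orthogonal_comp_iff mem_axis_plus_iff mem_frame_iff)
  qed
  \<comment> \<open>Composes \<open>cograph13\<close> with \<open>graph12\<close> through the first
    axis, giving \<open>y = alpha (beta z)\<close>.\<close>
  define N2 where "N2 = (graph12 + cograph13) \<inter> (axis2 + axis3)"
  have N2: "(x, y, z) \<in> N2 \<longleftrightarrow> x = 0 \<and> y = alpha (beta z)" for x y z
    by (auto simp: N2_def triple_plus_iff mem_cograph_iff mem_axis_plus_iff mem_frame_iff
        intro!: exI[of _ "- beta z"]) (metis alpha_minus)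
  have "{(0, 0, z) | z. bvec \<bullet> z = 0} = (axis2 + (N1 \<inter> N2)) \<inter> axis3"
  proof (rule triple_set_eqI)
    fix x y z
    \<comment> \<open>On the intersection \<open>alpha t = alpha (beta z)\<close> and
      \<open>z = beta t\<close>, so \<open>t = beta z\<close> and \<open>z = beta (beta z)\<close>.
      Joining with \<open>axis2\<close> and meeting with \<open>axis3\<close> projects to the third
      coordinate.\<close>
    have "(x, y, z) \<in> (axis2 + (N1 \<inter> N2)) \<inter> axis3 \<longleftrightarrow> x = 0 \<and> y = 0 \<and> beta (beta z) = z"
      by (auto simp: mem_axis_plus_iff mem_frame_iff N1 N2 alpha_inj)
    then show "(x, y, z) \<in> {(0, 0, z) | z. bvec \<bullet> z = 0} \<longleftrightarrow> (x, y, z) \<in> (axis2 + (N1 \<inter> N2)) \<inter> axis3"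
      by (simp add: beta_beta_fixed)
  qed
  then show ?thesis
    by (simp add: N0_def N1_def N2_def frame.comp frame.Int_mem frame.plus frame_mem cograph_mem)
qed

lemma mem_line_iff: "(x, y, z) \<in> span {(u, v, w)} \<longleftrightarrow> (\<exists>r. x = r *\<^sub>R u \<and> y = r *\<^sub>R v \<and> z = r *\<^sub>R w)"
  by (auto simp: span_singleton)

lemma line_bvec_mem: "span {(bvec, 0, 0)} \<in> frame_lattice"
proof -
  \<comment> \<open>Inside the third axis, the complement of the hyperplane is the line of
    \<open>bvec\<close>.\<close>
  have "span {(0, 0, bvec)} = {(0, 0, z) | z. bvec \<bullet> z = 0}\<^sup>\<bottom> \<inter> axis3"
  proof (rule triple_set_eqI)
    fix x y z
    have "\<exists>r. z = r *\<^sub>R bvec" if *: "\<And>w. bvec \<bullet> w = 0 \<Longrightarrow> w \<bullet> z = 0"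
    proof -
      define r where "r = (bvec \<bullet> z) / (bvec \<bullet> bvec)"
      have "bvec \<bullet> (z - r *\<^sub>R bvec) = 0"
        using bvec_nonzero by (simp add: r_def inner_diff_right)
      moreover from this have "(z - r *\<^sub>R bvec) \<bullet> z = 0" by (rule *)
      ultimately have "(z - r *\<^sub>R bvec) \<bullet> (z - r *\<^sub>R bvec) = 0"
        by (simp add: inner_diff_right inner_commute)
      then show ?thesis by auto
    qed
    then show "(x, y, z) \<in> span {(0, 0, bvec)} \<longleftrightarrow> (x, y, z) \<in> {(0, 0, z) | z. bvec \<bullet> z = 0}\<^sup>\<bottom> \<inter> axis3"
      by (auto simp: mem_line_iff triple_orthogonal_comp_iff mem_frame_iff inner_commute)
  qed
  then have L3: "span {(0, 0, bvec)} \<in> frame_lattice"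
    by (simp add: frame.comp frame.Int_mem frame_mem bvec_hyperplane_mem)
  \<comment> \<open>The line is carried to the first axis along \<open>graph13\<close>; it stays the
    line of \<open>bvec\<close> because \<open>bvec\<close> is an eigenvector of
    \<open>beta\<close>.\<close>
  have "span {(bvec, 0, 0)} = (span {(0, 0, bvec)} + graph13) \<inter> axis1"
  proof (rule triple_set_eqI)
    fix x y z
    have "(\<exists>r. - (r *\<^sub>R bvec) = - beta x) \<longleftrightarrow> (\<exists>r. x = r *\<^sub>R bvec)"
    proof
      assume "\<exists>r. - (r *\<^sub>R bvec) = - beta x"
      then obtain r where "beta x = r *\<^sub>R bvec" by (metis minus_minus)
      then have "x = (r - bvec \<bullet> x) *\<^sub>R bvec" by (simp add: beta_def algebra_simps)
      then show "\<exists>r. x = r *\<^sub>R bvec" ..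
    next
      assume "\<exists>r. x = r *\<^sub>R bvec"
      then obtain r where "x = r *\<^sub>R bvec" ..
      then have "- ((r * (1 + bvec \<bullet> bvec)) *\<^sub>R bvec) = - beta x"
        by (simp add: beta_scaleR beta_bvec)
      then show "\<exists>r. - (r *\<^sub>R bvec) = - beta x" ..
    qed
    moreover have "(x, y, z) \<in> (span {(0, 0, bvec)} + graph13) \<inter> axis1 \<longleftrightarrow>
        y = 0 \<and> z = 0 \<and> (\<exists>r. - (r *\<^sub>R bvec) = - beta x)"
      by (auto simp: mem_line_iff triple_plus_iff mem_frame_iff)
    ultimately show "(x, y, z) \<in> span {(bvec, 0, 0)} \<longleftrightarrow> (x, y, z) \<in> (span {(0, 0, bvec)} + graph13) \<inter> axis1"
      by (simp only: mem_line_iff scaleR_zero_right) blast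
  qed
  then show ?thesis
    by (simp add: frame.plus frame.Int_mem frame_mem L3)
qed

text \<open>Perspectivities between the axes. The first two together apply \<open>alpha\<close>
  twice and return to the first axis; the last two lift a line onto a graph, giving lines that are
  oblique to two axes.\<close>

lemma line_moves:
  "span {(x, 0, 0)} \<in> frame_lattice \<Longrightarrow> span {(0, alpha x, 0)} \<in> frame_lattice"
  "span {(0, x, 0)} \<in> frame_lattice \<Longrightarrow> span {(alpha x, 0, 0)} \<in> frame_lattice"
  "span {(x, 0, 0)} \<in> frame_lattice \<Longrightarrow> span {(0, 0, beta x)} \<in> frame_lattice"
  "span {(x, 0, 0)} \<in> frame_lattice \<Longrightarrow> span {(x, - alpha x, 0)} \<in> frame_lattice"
  "span {(x, 0, 0)} \<in> frame_lattice \<Longrightarrow> span {(x, 0, - beta x)} \<in> frame_lattice"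
proof -
  have "span {(0, alpha x, 0)} = (span {(x, 0, 0)} + graph12) \<inter> axis2"
    by (rule triple_set_eqI) (auto simp: mem_line_iff triple_plus_iff mem_frame_iff alpha_scaleR)
  then show "span {(x, 0, 0)} \<in> frame_lattice \<Longrightarrow> span {(0, alpha x, 0)} \<in> frame_lattice"
    by (simp add: frame.plus frame.Int_mem frame_mem)
  have "span {(alpha x, 0, 0)} = (span {(0, x, 0)} + cograph12) \<inter> axis1"
  proof (rule triple_set_eqI)
    fix u v w
    have "(\<exists>r. u = r *\<^sub>R alpha x) \<longleftrightarrow> (\<exists>r. u = alpha (- (r *\<^sub>R x)))"
      by (metis alpha_scaleR scaleR_minus_left minus_minus)
    then show "(u, v, w) \<in> span {(alpha x, 0, 0)} \<longleftrightarrow> (u, v, w) \<in> (span {(0, x, 0)} + cograph12) \<inter> axis1"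
      by (auto simp: mem_line_iff triple_plus_iff mem_frame_iff mem_cograph_iff)
  qed
  then show "span {(0, x, 0)} \<in> frame_lattice \<Longrightarrow> span {(alpha x, 0, 0)} \<in> frame_lattice"
    by (simp add: frame.plus frame.Int_mem frame_mem cograph_mem)
  have "span {(0, 0, beta x)} = (span {(x, 0, 0)} + graph13) \<inter> axis3"
    by (rule triple_set_eqI) (auto simp: mem_line_iff triple_plus_iff mem_frame_iff beta_scaleR)
  then show "span {(x, 0, 0)} \<in> frame_lattice \<Longrightarrow> span {(0, 0, beta x)} \<in> frame_lattice"
    by (simp add: frame.plus frame.Int_mem frame_mem)
  have "span {(x, - alpha x, 0)} = (axis2 + span {(x, 0, 0)}) \<inter> graph12"
    by (rule triple_set_eqI) (auto simp: mem_line_iff mem_axis_plus_iff mem_frame_iff alpha_scaleR)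
  then show "span {(x, 0, 0)} \<in> frame_lattice \<Longrightarrow> span {(x, - alpha x, 0)} \<in> frame_lattice"
    by (simp add: frame.plus frame.Int_mem frame_mem)
  have "span {(x, 0, - beta x)} = (axis3 + span {(x, 0, 0)}) \<inter> graph13"
    by (rule triple_set_eqI) (auto simp: mem_line_iff mem_axis_plus_iff mem_frame_iff beta_scaleR)
  then show "span {(x, 0, 0)} \<in> frame_lattice \<Longrightarrow> span {(x, 0, - beta x)} \<in> frame_lattice"
    by (simp add: frame.plus frame.Int_mem frame_mem)
qed

abbreviation "power_vec k \<equiv> (alpha ^^ (2 * k)) bvec"

lemma line_power_vec_mem: "span {(power_vec k, 0, 0)} \<in> frame_lattice"
proof (induction k)
  case (Suc k)
  then show ?case using line_moves(2)[OF line_moves(1)[OF Suc]] by simp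
qed (simp add: line_bvec_mem)

definition line_vecs :: "(wseq \<times> wseq \<times> wseq) set" where
  "line_vecs = (\<Union>k. {(power_vec k, 0, 0), (0, alpha (power_vec k), 0), (0, 0, beta (power_vec k))})"

lemma line_vecs_mem: "v \<in> line_vecs \<Longrightarrow> span {v} \<in> frame_lattice"
  using line_power_vec_mem line_moves(1)[OF line_power_vec_mem] line_moves(3)[OF line_power_vec_mem]
  by (auto simp: line_vecs_def)

text \<open>Self-adjointness moves \<open>alpha\<close> and \<open>beta\<close> onto the coordinates
  of \<open>z\<close>, so that \<open>funpow_alpha_bvec_dense\<close> applies to each; injectivity
  then removes them again.\<close>

lemma line_vecs_dense:
  assumes "z \<noteq> 0"
  shows "\<exists>v\<in>line_vecs. v \<bullet> z \<noteq> 0"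
proof (rule ccontr)
  assume "\<not> (\<exists>v\<in>line_vecs. v \<bullet> z \<noteq> 0)"
  then have *: "\<And>v. v \<in> line_vecs \<Longrightarrow> v \<bullet> z = 0" by blast
  obtain z1 z2 z3 where z: "z = (z1, z2, z3)" by (cases z)
  have "power_vec k \<bullet> z1 = 0" "power_vec k \<bullet> alpha z2 = 0" "power_vec k \<bullet> beta z3 = 0" for k
    using *[of "(power_vec k, 0, 0)"] *[of "(0, alpha (power_vec k), 0)"]
      *[of "(0, 0, beta (power_vec k))"]
    by (auto simp: line_vecs_def z simp flip: alpha_self_adjoint beta_self_adjoint)
  then have "z1 = 0" "alpha z2 = 0" "beta z3 = 0"
    using funpow_alpha_bvec_dense by blast+
  then show False using assms by (simp add: z zero_prod_def)
qed

text \<open>Vectors on different axes are orthogonal, so from the second and third axes the path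
  runs through the oblique vectors \<open>?p2\<close> and \<open>?p3\<close>, which lie on the
  graphs over \<open>bvec\<close>.\<close>

lemma line_vecs_connected:
  assumes "v \<in> line_vecs"
  shows "(v, (bvec, 0, 0)) \<in> {(v, w). span {v} \<in> frame_lattice \<and> span {w} \<in> frame_lattice \<and> v \<bullet> w \<noteq> 0}\<^sup>*"
    (is "_ \<in> ?R\<^sup>*")
proof -
  have bb: "bvec \<bullet> bvec \<noteq> 0" using bvec_nonzero by simp
  have pos: "power_vec k \<bullet> bvec \<noteq> 0" for k using inner_funpow_alpha_bvec_pos[of k] by simp
  have v: "span {v} \<in> frame_lattice" by (rule line_vecs_mem[OF assms])
  let ?p2 = "(bvec, - alpha bvec, 0)" and ?p3 = "(bvec, 0, - beta bvec)"
  have p2: "(?p2, (bvec, 0, 0)) \<in> ?R" and p3: "(?p3, (bvec, 0, 0)) \<in> ?R"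
    using line_bvec_mem line_moves(4,5)[OF line_bvec_mem] bb by simp_all
  obtain k where "v = (power_vec k, 0, 0) \<or> v = (0, alpha (power_vec k), 0) \<or> v = (0, 0, beta (power_vec k))"
    using assms by (auto simp: line_vecs_def)
  then consider "v = (power_vec k, 0, 0)" | "v = (0, alpha (power_vec k), 0)" | "v = (0, 0, beta (power_vec k))"
    by blast
  then show ?thesis
  proof cases
    case 1
    then have "(v, (bvec, 0, 0)) \<in> ?R" using v line_bvec_mem pos by simp
    then show ?thesis by blast
  next
    case 2
    \<comment> \<open>Moving one \<open>alpha\<close> across yields the next even power, whose inner
      product with \<open>bvec\<close> is again positive.\<close>
    have "alpha (power_vec k) \<bullet> alpha bvec = power_vec (Suc k) \<bullet> bvec"
      by (simp flip: alpha_self_adjoint)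
    then have "(v, ?p2) \<in> ?R" using 2 v line_moves(4)[OF line_bvec_mem] pos[of "Suc k"] by simp
    then show ?thesis using p2 by (meson converse_rtrancl_into_rtrancl r_into_rtrancl)
  next
    case 3
    have "beta (power_vec k) \<bullet> beta bvec = (1 + bvec \<bullet> bvec) * (1 + bvec \<bullet> bvec) * (power_vec k \<bullet> bvec)"
      by (simp add: beta_self_adjoint beta_bvec beta_scaleR)
    then have "(v, ?p3) \<in> ?R"
      using 3 v line_moves(5)[OF line_bvec_mem] pos[of k] one_plus_bvec by simp
    then show ?thesis using p3 by (meson converse_rtrancl_into_rtrancl r_into_rtrancl)
  qed
qed

theorem corollary4p16:
  shows "\<exists>(L :: nat ortho_gorder) a c.
    modular_ortholattice L \<and> subdirectly_irreducible L \<and> infinite_height L \<and>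
    orthogonal_frame3 L a c \<and> ol_generated_by L (frame_elements a c)"
proof (intro exI conjI)
  show "modular_ortholattice frame.coded_lattice"
    by (rule frame.modular_ortholattice_K)
  show "subdirectly_irreducible frame.coded_lattice"
    by (rule frame.subdirectly_irreducible_K[OF line_bvec_mem _ line_vecs_dense
          line_vecs_connected line_vecs_mem]) (simp_all add: zero_prod_def bvec_nonzero)
  show "infinite_height frame.coded_lattice"
  proof (rule frame.infinite_height_K)
    show "\<exists>v. span {v} \<in> frame_lattice \<and> v \<bullet> z \<noteq> 0" if "z \<noteq> 0" for z
      using line_vecs_dense[OF that] line_vecs_mem by blast
  qed (rule infinite_dimensional_wseq)
  show "orthogonal_frame3 frame.coded_lattice atom_at link_at"
    by (rule orthogonal_frame)
  show "ol_generated_by frame.coded_lattice (frame_elements atom_at link_at)"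
    by (rule generated_by_frame)
qed

end
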